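(* For any quaternionic $C_n$-representation $W$ and any integers $k$ and $r$, there is a cofiber sequence $$\mathrm{P}_{\mathbb{H}}^{r}(W)_{+}\hookrightarrow \mathrm{P}_{\mathbb{H}}^{r}(W\oplus \Psi_k)_{+}\to \begin{cases} S^{|W(r;\mathbb{C})|} & \text{if }k\equiv\pm r\bmod n,\\ \mathrm{pt} & \text{otherwise.}\end{cases}$$
   Context: Let $n\ge1$, $\mathbf{1}_n$ the usual generator of $C_n$, $\zeta_n=e^{2\pi i/n}$. A complex (resp. quaternionic) $C_n$-representation is a complex vector space (resp. left $\mathbb{H}$-module) with $C_n$ acting by $\mathbb{C}$-linear (resp. left $\mathbb{H}$-linear) maps; quaternionic representations are regarded as complex ones by restriction of scalars. For an integer $r$, $\Phi_r$ is $\mathbb{C}$ with $\mathbf{1}_n\cdot z=z\zeta_n^r$, and $\Psi_r$ is $\mathbb{H}$ with $\mathbf{1}_n\cdot q=q\zeta_n^r$. $W(r;\mathbb{C})$ is the sum of all complex subrepresentations of $W$ isomorphic to $\Phi_r$, and $W(r;\mathbb{H})$ the sum of all quaternionic subrepresentations isomorphic to $\Psi_r$. $|V|$ always denotes real dimension. For $K=\mathbb{C}$ or $\mathbb{H}$, $\mathrm{P}_K(V)=(V\setminus\{0\})/{\sim}$ with $v\sim\lambda v$ for $\lambda\in K^\times$. Define $$\mathrm{P}^r_{\mathbb{H}}(W)=\begin{cases}\mathrm{P}_{\mathbb{H}}(W(r;\mathbb{H}))&\text{if }2r\equiv0\bmod n,\\ \mathrm{P}_{\mathbb{C}}(W(r;\mathbb{C}))&\text{otherwise.}\end{cases}$$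 These spaces have trivial $C_n$-action. $X_+$ is $X$ with a disjoint basepoint; $S^m$ for an integer $m$ is the $m$-sphere with trivial action. The first map is induced by the inclusion $W\subset W\oplus\Psi_k$. *)

theory Defs
  imports
    "HOL-Analysis.Analysis"
    "HOL-Algebra.Elementary_Groups"
    "HOL-Algebra.Group_Action"
    "HOL-Number_Theory.Cong"
begin

section \<open>Quaternions\<close>

datatype quat = Quat (qRe: real) (qI: real) (qJ: real) (qK: real)

lemma quat_eq_iff: "p = q \<longleftrightarrow> qRe p = qRe q \<and> qI p = qI q \<and> qJ p = qJ q \<and> qK p = qK q"
  by (auto intro: quat.expand)

instantiation quat :: ring_1
begin

definition zero_quat :: quat where "0 = Quat 0 0 0 0"

definition one_quat :: quat where "1 = Quat 1 0 0 0"

definition plus_quat :: "quat \<Rightarrow> quat \<Rightarrow> quat" where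
  "p + q = Quat (qRe p + qRe q) (qI p + qI q) (qJ p + qJ q) (qK p + qK q)"

definition uminus_quat :: "quat \<Rightarrow> quat" where
  "- p = Quat (- qRe p) (- qI p) (- qJ p) (- qK p)"

definition minus_quat :: "quat \<Rightarrow> quat \<Rightarrow> quat" where
  "p - q = Quat (qRe p - qRe q) (qI p - qI q) (qJ p - qJ q) (qK p - qK q)"

definition times_quat :: "quat \<Rightarrow> quat \<Rightarrow> quat" where
  "p * q = Quat
     (qRe p * qRe q - qI p * qI q - qJ p * qJ q - qK p * qK q)
     (qRe p * qI q + qI p * qRe q + qJ p * qK q - qK p * qJ q)
     (qRe p * qJ q - qI p * qK q + qJ p * qRe q + qK p * qI q)
     (qRe p * qK q + qI p * qJ q - qJ p * qI q + qK p * qRe q)"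

instance
proof
  fix p q s :: quat
  show "p * q * s = p * (q * s)"
    unfolding times_quat_def quat_eq_iff quat.sel by (intro conjI; algebra)
qed (simp_all add: zero_quat_def one_quat_def plus_quat_def uminus_quat_def minus_quat_def
      times_quat_def quat_eq_iff algebra_simps)

end

lemma quat_sel_ring [simp]:
  "qRe 0 = 0" "qI 0 = 0" "qJ 0 = 0" "qK 0 = 0"
  "qRe 1 = 1" "qI 1 = 0" "qJ 1 = 0" "qK 1 = 0"
  "qRe (p + q) = qRe p + qRe q" "qI (p + q) = qI p + qI q"
  "qJ (p + q) = qJ p + qJ q" "qK (p + q) = qK p + qK q"
  "qRe (- p) = - qRe p" "qI (- p) = - qI p" "qJ (- p) = - qJ p" "qK (- p) = - qK p"
  "qRe (p - q) = qRe p - qRe q" "qI (p - q) = qI p - qI q"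
  "qJ (p - q) = qJ p - qJ q" "qK (p - q) = qK p - qK q"
  "qRe (p * q) = qRe p * qRe q - qI p * qI q - qJ p * qJ q - qK p * qK q"
  "qI (p * q) = qRe p * qI q + qI p * qRe q + qJ p * qK q - qK p * qJ q"
  "qJ (p * q) = qRe p * qJ q - qI p * qK q + qJ p * qRe q + qK p * qI q"
  "qK (p * q) = qRe p * qK q + qI p * qJ q - qJ p * qI q + qK p * qRe q"
  by (simp_all add: zero_quat_def one_quat_def plus_quat_def uminus_quat_def minus_quat_def
      times_quat_def)

instantiation quat :: real_algebra_1
begin

definition scaleR_quat :: "real \<Rightarrow> quat \<Rightarrow> quat" where
  "scaleR t q = Quat (t * qRe q) (t * qI q) (t * qJ q) (t * qK q)"

instance
  by standard (simp_all add: scaleR_quat_def quat_eq_iff algebra_simps)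

end

lemma quat_sel_scaleR [simp]:
  "qRe (t *\<^sub>R q) = t * qRe q" "qI (t *\<^sub>R q) = t * qI q"
  "qJ (t *\<^sub>R q) = t * qJ q" "qK (t *\<^sub>R q) = t * qK q"
  by (simp_all add: scaleR_quat_def)

instantiation quat :: real_inner
begin

definition inner_quat :: "quat \<Rightarrow> quat \<Rightarrow> real" where
  "p \<bullet> q = qRe p * qRe q + qI p * qI q + qJ p * qJ q + qK p * qK q"

definition norm_quat :: "quat \<Rightarrow> real" where "norm (q :: quat) = sqrt (q \<bullet> q)"

definition sgn_quat :: "quat \<Rightarrow> quat" where "sgn (q :: quat) = q /\<^sub>R norm q"

definition dist_quat :: "quat \<Rightarrow> quat \<Rightarrow> real" where "dist (p :: quat) q = norm (p - q)"

definition uniformity_quat :: "(quat \<times> quat) filter" where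
  "uniformity = (INF e\<in>{0 <..}. principal {(x :: quat, y). dist x y < e})"

definition open_quat :: "quat set \<Rightarrow> bool" where
  "open (U :: quat set) \<longleftrightarrow> (\<forall>x\<in>U. eventually (\<lambda>(x', y). x' = x \<longrightarrow> y \<in> U) uniformity)"

instance
proof
  fix p q s :: quat and t :: real and U :: "quat set"
  show "p \<bullet> q = q \<bullet> p" "(p + q) \<bullet> s = p \<bullet> s + q \<bullet> s" "(t *\<^sub>R p) \<bullet> q = t * (p \<bullet> q)"
    by (simp_all add: inner_quat_def algebra_simps)
  show "0 \<le> p \<bullet> p"
    by (simp add: inner_quat_def)
  show "p \<bullet> p = 0 \<longleftrightarrow> p = 0"
    by (simp add: inner_quat_def quat_eq_iff add_nonneg_eq_0_iff)
qed (rule sgn_quat_def dist_quat_def open_quat_def uniformity_quat_def norm_quat_def)+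

end

instantiation quat :: real_normed_div_algebra
begin

definition inverse_quat :: "quat \<Rightarrow> quat" where
  "inverse q = Quat (qRe q) (- qI q) (- qJ q) (- qK q) /\<^sub>R (q \<bullet> q)"

definition "p div q = p * inverse q" for p q :: quat

instance
proof
  fix p q :: quat
  have "Quat (qRe q) (- qI q) (- qJ q) (- qK q) * q = (q \<bullet> q) *\<^sub>R 1"
    "q * Quat (qRe q) (- qI q) (- qJ q) (- qK q) = (q \<bullet> q) *\<^sub>R 1"
    by (simp_all add: quat_eq_iff inner_quat_def)
  then show "inverse q * q = 1" "q * inverse q = 1" if "q \<noteq> 0"
    using that by (simp_all add: inverse_quat_def)
  show "p div q = p * inverse q"
    by (rule divide_quat_def)
  show "inverse (0 :: quat) = 0"
    by (simp add: inverse_quat_def quat_eq_iff)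
  have "(p * q) \<bullet> (p * q) = (p \<bullet> p) * (q \<bullet> q)"
    unfolding inner_quat_def quat_sel_ring by algebra
  then show "norm (p * q) = norm p * norm q"
    by (simp add: norm_quat_def real_sqrt_mult)
qed

end

instantiation quat :: euclidean_space
begin

definition Basis_quat :: "quat set" where
  "Basis = {Quat 1 0 0 0, Quat 0 1 0 0, Quat 0 0 1 0, Quat 0 0 0 1}"

instance
proof
  show "(Basis :: quat set) \<noteq> {}" "finite (Basis :: quat set)"
    by (simp_all add: Basis_quat_def)
  show "u \<bullet> v = (if u = v then 1 else 0)" if "u \<in> Basis" "v \<in> Basis" for u v :: quat
    using that unfolding Basis_quat_def inner_quat_def
    by (elim insertE emptyE; hypsubst; simp)
  show "(\<forall>u\<in>Basis. x \<bullet> u = 0) \<longleftrightarrow> x = 0" for x :: quat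
    by (simp add: Basis_quat_def inner_quat_def quat_eq_iff [of x])
qed

end

definition quat_of_complex :: "complex \<Rightarrow> quat" where
  "quat_of_complex z = Quat (Re z) (Im z) 0 0"


section \<open>Representations of finite cyclic groups\<close>

text \<open>
  Finite-dimensional \<open>K\<close>-modules are modelled as real subspaces of a Euclidean space, with a
  left scalar multiplication that is only constrained on the subspace.  The subspace may be
  zero, and it carries its canonical topology as a finite-dimensional real vector space.
\<close>

record ('k, 'a) rep =
  rep_space :: "'a set"
  rep_scale :: "'k \<Rightarrow> 'a \<Rightarrow> 'a"
  rep_act :: "int \<Rightarrow> 'a \<Rightarrow> 'a"

definition is_left_module :: "('k::real_algebra_1 \<Rightarrow> 'a::real_vector \<Rightarrow> 'a) \<Rightarrow> 'a set \<Rightarrow> bool" where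
  "is_left_module s V \<longleftrightarrow>
     subspace V \<and>
     (\<forall>c. \<forall>v\<in>V. s c v \<in> V) \<and>
     (\<forall>c. \<forall>v\<in>V. \<forall>w\<in>V. s c (v + w) = s c v + s c w) \<and>
     (\<forall>c d. \<forall>v\<in>V. s (c + d) v = s c v + s d v) \<and>
     (\<forall>c d. \<forall>v\<in>V. s (c * d) v = s c (s d v)) \<and>
     (\<forall>t. \<forall>v\<in>V. s (of_real t) v = t *\<^sub>R v)"

text \<open>
  \<open>C\<^sub>n\<close> is \<open>integer_mod_group n\<close>, with carrier \<open>{0..<n}\<close>.  The library's group actions on
  a set consist of extensional functions, whence the uses of \<open>restrict\<close> below.
\<close>

definition is_rep :: "nat \<Rightarrow> ('k::real_algebra_1, 'a::real_vector) rep \<Rightarrow> bool" where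
  "is_rep n V \<longleftrightarrow>
     is_left_module (rep_scale V) (rep_space V) \<and>
     group_action (integer_mod_group n) (rep_space V) (rep_act V) \<and>
     (\<forall>j\<in>carrier (integer_mod_group n).
        (\<forall>v\<in>rep_space V. \<forall>w\<in>rep_space V.
           rep_act V j (v + w) = rep_act V j v + rep_act V j w) \<and>
        (\<forall>c. \<forall>v\<in>rep_space V. rep_act V j (rep_scale V c v) = rep_scale V c (rep_act V j v)))"

definition restrict_scalars :: "(quat, 'a) rep \<Rightarrow> (complex, 'a) rep" where
  "restrict_scalars V =
     \<lparr>rep_space = rep_space V, rep_scale = (\<lambda>z. rep_scale V (quat_of_complex z)),
      rep_act = rep_act V\<rparr>"

definition direct_sum :: "('k, 'a) rep \<Rightarrow> ('k, 'b) rep \<Rightarrow> ('k, 'a \<times> 'b) rep" where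
  "direct_sum V V' =
     \<lparr>rep_space = rep_space V \<times> rep_space V',
      rep_scale = (\<lambda>c (v, v'). (rep_scale V c v, rep_scale V' c v')),
      rep_act = (\<lambda>j. restrict (\<lambda>(v, v'). (rep_act V j v, rep_act V' j v'))
                              (rep_space V \<times> rep_space V'))\<rparr>"

definition zeta :: "nat \<Rightarrow> complex" where
  "zeta n = exp (2 * of_real pi * \<i> / of_nat n)"

definition Phi :: "nat \<Rightarrow> int \<Rightarrow> (complex, complex) rep" where
  "Phi n r =
     \<lparr>rep_space = UNIV, rep_scale = (*), rep_act = (\<lambda>j z. z * (zeta n powi r) powi j)\<rparr>"

definition Psi :: "nat \<Rightarrow> int \<Rightarrow> (quat, quat) rep" where
  "Psi n r =
     \<lparr>rep_space = UNIV, rep_scale = (*),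
      rep_act = (\<lambda>j q. q * quat_of_complex ((zeta n powi r) powi j))\<rparr>"

definition is_subrep :: "nat \<Rightarrow> ('k, 'a::real_vector) rep \<Rightarrow> 'a set \<Rightarrow> bool" where
  "is_subrep n V U \<longleftrightarrow>
     U \<subseteq> rep_space V \<and> subspace U \<and>
     (\<forall>c. \<forall>u\<in>U. rep_scale V c u \<in> U) \<and>
     (\<forall>j\<in>carrier (integer_mod_group n). \<forall>u\<in>U. rep_act V j u \<in> U)"

definition subrep :: "('k, 'a) rep \<Rightarrow> 'a set \<Rightarrow> ('k, 'a) rep" where
  "subrep V U =
     \<lparr>rep_space = U, rep_scale = rep_scale V, rep_act = (\<lambda>j. restrict (rep_act V j) U)\<rparr>"

definition isomorphic_reps ::
    "nat \<Rightarrow> ('k, 'a::real_vector) rep \<Rightarrow> ('k, 'b::real_vector) rep \<Rightarrow> bool" where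
  "isomorphic_reps n V V' \<longleftrightarrow>
     (\<exists>f. bij_betw f (rep_space V) (rep_space V') \<and>
          (\<forall>v\<in>rep_space V. \<forall>w\<in>rep_space V. f (v + w) = f v + f w) \<and>
          (\<forall>c. \<forall>v\<in>rep_space V. f (rep_scale V c v) = rep_scale V' c (f v)) \<and>
          (\<forall>j\<in>carrier (integer_mod_group n). \<forall>v\<in>rep_space V.
             f (rep_act V j v) = rep_act V' j (f v)))"

text \<open>
  The sum of a family of subrepresentations is the real span of their union, since each of them
  is closed under the scalar multiplication.
\<close>

definition isotypic :: "nat \<Rightarrow> ('k, 'a::real_vector) rep \<Rightarrow> ('k, 'b::real_vector) rep \<Rightarrow> 'a set" where
  "isotypic n V S = span (\<Union>{U. is_subrep n V U \<and> isomorphic_reps n (subrep V U) S})"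

definition isotypic_C :: "nat \<Rightarrow> int \<Rightarrow> (quat, 'a::real_vector) rep \<Rightarrow> 'a set" where
  "isotypic_C n r W = isotypic n (restrict_scalars W) (Phi n r)"

definition isotypic_H :: "nat \<Rightarrow> int \<Rightarrow> (quat, 'a::real_vector) rep \<Rightarrow> 'a set" where
  "isotypic_H n r W = isotypic n W (Psi n r)"


section \<open>Quotient spaces, disjoint unions and projective spaces\<close>

definition quotient_topology :: "'a topology \<Rightarrow> ('a \<Rightarrow> 'b) \<Rightarrow> 'b topology" where
  "quotient_topology X q =
     topology (\<lambda>U. U \<subseteq> q ` topspace X \<and> openin X {x \<in> topspace X. q x \<in> U})"

lemma openin_quotient_topology:
  "openin (quotient_topology X q) U \<longleftrightarrow>
     U \<subseteq> q ` topspace X \<and> openin X {x \<in> topspace X. q x \<in> U}"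
proof -
  have "istopology (\<lambda>U. U \<subseteq> q ` topspace X \<and> openin X {x \<in> topspace X. q x \<in> U})"
    unfolding istopology_def
  proof (intro conjI allI impI)
    fix S T
    assume "S \<subseteq> q ` topspace X \<and> openin X {x \<in> topspace X. q x \<in> S}"
      and "T \<subseteq> q ` topspace X \<and> openin X {x \<in> topspace X. q x \<in> T}"
    moreover have "{x \<in> topspace X. q x \<in> S \<inter> T} =
        {x \<in> topspace X. q x \<in> S} \<inter> {x \<in> topspace X. q x \<in> T}"
      by blast
    ultimately show "S \<inter> T \<subseteq> q ` topspace X" "openin X {x \<in> topspace X. q x \<in> S \<inter> T}"
      by (auto intro: openin_Int)
  next
    fix \<K>
    assume *: "\<forall>K\<in>\<K>. K \<subseteq> q ` topspace X \<and> openin X {x \<in> topspace X. q x \<in> K}"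
    then show "\<Union>\<K> \<subseteq> q ` topspace X"
      by blast
    have "{x \<in> topspace X. q x \<in> \<Union>\<K>} = (\<Union>K\<in>\<K>. {x \<in> topspace X. q x \<in> K})"
      by blast
    then show "openin X {x \<in> topspace X. q x \<in> \<Union>\<K>}"
      using * by (auto intro: openin_Union)
  qed
  then show ?thesis
    by (simp add: quotient_topology_def)
qed

lemma topspace_quotient_topology [simp]: "topspace (quotient_topology X q) = q ` topspace X"
proof
  show "topspace (quotient_topology X q) \<subseteq> q ` topspace X"
    by (metis openin_quotient_topology openin_topspace)
  have "openin (quotient_topology X q) (q ` topspace X)"
  proof -
    have "{x \<in> topspace X. q x \<in> q ` topspace X} = topspace X"
      by blast
    then show ?thesis
      by (simp add: openin_quotient_topology)
  qed
  then show "q ` topspace X \<subseteq> topspace (quotient_topology X q)"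
    by (rule openin_subset)
qed

lemma quotient_map_quotient_topology: "quotient_map X (quotient_topology X q) q"
  by (auto simp: quotient_map_def openin_quotient_topology)

definition disjoint_union :: "'a topology \<Rightarrow> 'b topology \<Rightarrow> ('a + 'b) topology" where
  "disjoint_union X Y =
     topology (\<lambda>U. openin X (Inl -` U) \<and> openin Y (Inr -` U))"

lemma openin_disjoint_union:
  "openin (disjoint_union X Y) U \<longleftrightarrow> openin X (Inl -` U) \<and> openin Y (Inr -` U)"
proof -
  have "istopology (\<lambda>U. openin X (Inl -` U) \<and> openin Y (Inr -` U))"
    by (auto simp: istopology_def vimage_Union)
  then show ?thesis
    by (simp add: disjoint_union_def)
qed

lemma topspace_disjoint_union [simp]:
  "topspace (disjoint_union X Y) = topspace X <+> topspace Y"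
proof
  have "openin X (Inl -` topspace (disjoint_union X Y))"
    "openin Y (Inr -` topspace (disjoint_union X Y))"
    using openin_topspace [of "disjoint_union X Y"] unfolding openin_disjoint_union by auto
  then have sub: "Inl -` topspace (disjoint_union X Y) \<subseteq> topspace X"
    "Inr -` topspace (disjoint_union X Y) \<subseteq> topspace Y"
    by (auto dest: openin_subset)
  show "topspace (disjoint_union X Y) \<subseteq> topspace X <+> topspace Y"
  proof
    fix z assume "z \<in> topspace (disjoint_union X Y)"
    with sub show "z \<in> topspace X <+> topspace Y"
      by (cases z) auto
  qed
  have "Inl -` (topspace X <+> topspace Y) = topspace X"
    "Inr -` (topspace X <+> topspace Y) = topspace Y"
    by auto
  then have "openin (disjoint_union X Y) (topspace X <+> topspace Y)"
    by (simp add: openin_disjoint_union)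
  then show "topspace X <+> topspace Y \<subseteq> topspace (disjoint_union X Y)"
    by (rule openin_subset)
qed

text \<open>The point of \<open>v\<close> is its orbit under \<open>K\<^sup>\<times> = K - {0}\<close>.\<close>

definition projective_space ::
    "('k::division_ring \<Rightarrow> 'a::{zero,topological_space} \<Rightarrow> 'a) \<Rightarrow> 'a set \<Rightarrow> 'a set topology" where
  "projective_space s V = quotient_topology (top_of_set (V - {0})) (\<lambda>v. {s c v | c. c \<noteq> 0})"

definition P_H ::
    "nat \<Rightarrow> int \<Rightarrow> (quat, 'a::{real_vector,topological_space}) rep \<Rightarrow> 'a set topology" where
  "P_H n r W =
     (if [2 * r = 0] (mod int n)
      then projective_space (rep_scale W) (isotypic_H n r W)
      else projective_space (rep_scale (restrict_scalars W)) (isotypic_C n r W))"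


section \<open>Pointed spaces and cofiber sequences\<close>

type_synonym 'a pointed = "'a topology \<times> 'a"

definition add_basepoint :: "'a topology \<Rightarrow> ('a + unit) pointed" where
  "add_basepoint X = (disjoint_union X (discrete_topology {()}), Inr ())"

definition pointed_map :: "'a pointed \<Rightarrow> 'b pointed \<Rightarrow> ('a \<Rightarrow> 'b) \<Rightarrow> bool" where
  "pointed_map X Y f \<longleftrightarrow> continuous_map (fst X) (fst Y) f \<and> f (snd X) = snd Y"

definition pointed_homotopic :: "'a pointed \<Rightarrow> 'b pointed \<Rightarrow> ('a \<Rightarrow> 'b) \<Rightarrow> ('a \<Rightarrow> 'b) \<Rightarrow> bool" where
  "pointed_homotopic X Y f g \<longleftrightarrow> homotopic_with (\<lambda>h. h (snd X) = snd Y) (fst X) (fst Y) f g"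

definition pointed_homotopy_equivalence :: "'a pointed \<Rightarrow> 'b pointed \<Rightarrow> ('a \<Rightarrow> 'b) \<Rightarrow> bool" where
  "pointed_homotopy_equivalence X Y h \<longleftrightarrow>
     pointed_map X Y h \<and>
     (\<exists>h'. pointed_map Y X h' \<and>
           pointed_homotopic X X (h' \<circ> h) id \<and> pointed_homotopic Y Y (h \<circ> h') id)"

text \<open>
  The reduced mapping cone of a pointed map \<open>f : A \<rightarrow> X\<close> is the quotient of \<open>X \<squnion> (A \<times> [0,1])\<close> by
  the relations \<open>(a, 1) \<sim> f a\<close>, \<open>(a, 0) \<sim> x\<^sub>0\<close> and \<open>(a\<^sub>0, t) \<sim> x\<^sub>0\<close>.  The function below sends
  each point to a normal form of its class, so that its fibres are the equivalence classes.
\<close>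

fun cone_class ::
    "'a pointed \<Rightarrow> ('a \<Rightarrow> 'b) \<Rightarrow> 'b pointed \<Rightarrow> 'b + 'a \<times> real \<Rightarrow> 'b + 'a \<times> real" where
  "cone_class A f X (Inl x) = Inl x"
| "cone_class A f X (Inr (a, t)) =
     (if t = 0 \<or> a = snd A then Inl (snd X) else if t = 1 then Inl (f a) else Inr (a, t))"

definition mapping_cone ::
    "'a pointed \<Rightarrow> ('a \<Rightarrow> 'b) \<Rightarrow> 'b pointed \<Rightarrow> ('b + 'a \<times> real) pointed" where
  "mapping_cone A f X =
     (quotient_topology
        (disjoint_union (fst X) (prod_topology (fst A) (top_of_set {0..1})))
        (cone_class A f X),
      Inl (snd X))"

text \<open>
  \<open>A \<rightarrow> X \<rightarrow> C\<close> is a cofiber sequence if the second map is, up to pointed homotopy and a pointed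
  homotopy equivalence, the canonical map \<open>Inl\<close> from \<open>X\<close> to the mapping cone of the first.
\<close>

definition cofiber_sequence ::
    "'a pointed \<Rightarrow> ('a \<Rightarrow> 'b) \<Rightarrow> 'b pointed \<Rightarrow> ('b \<Rightarrow> 'c) \<Rightarrow> 'c pointed \<Rightarrow> bool" where
  "cofiber_sequence A f X g C \<longleftrightarrow>
     pointed_map A X f \<and> pointed_map X C g \<and>
     (\<exists>h. pointed_homotopy_equivalence (mapping_cone A f X) C h \<and>
          pointed_homotopic X C (h \<circ> Inl) g)"

definition sphere_point :: "nat \<Rightarrow> real" where
  "sphere_point = (\<lambda>i. if i = 0 then 1 else 0)"

definition pointed_sphere :: "nat \<Rightarrow> (nat \<Rightarrow> real) pointed" where
  "pointed_sphere m = (nsphere m, sphere_point)"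

definition pointed_pt :: "(nat \<Rightarrow> real) pointed" where
  "pointed_pt = (discrete_topology {sphere_point}, sphere_point)"

text \<open>
  The map \<open>P(V)\<^sub>+ \<rightarrow> P(V \<oplus> V')\<^sub>+\<close> induced by \<open>v \<mapsto> (v, 0)\<close>.  A point of \<open>P(V)\<close> is an orbit, and the
  image of the orbit of \<open>v\<close> under the inclusion is the orbit of \<open>(v, 0)\<close>.
\<close>

definition projective_inclusion :: "'a set + unit \<Rightarrow> ('a \<times> 'b::zero) set + unit" where
  "projective_inclusion = map_sum (\<lambda>L. (\<lambda>v. (v, 0)) ` L) id"

end

theory Submission
  imports Defs
begin

text \<open>
  Both projective spaces in the theorem are projective spaces of eigenspaces.  Let \<open>V\<close> be the set of
  vectors of \<open>W\<close> on which each \<open>j\<close> in \<open>C\<^sub>n\<close> acts as the scalar \<open>\<zeta>\<^sup>r\<^sup>j\<close>.  It is always a complex subspace, and a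
  quaternionic one if \<open>2r \<equiv> 0\<close>, since \<open>\<zeta>\<^sup>r\<close> is then real, hence central in the quaternions.  With \<open>K\<close> the complex
  numbers or, if \<open>2r \<equiv> 0\<close>, the quaternions, the isotypic part is exactly \<open>V\<close>
  (\<open>isotypic_eq_eigenspace\<close>).  For \<open>W \<oplus> \<Psi>\<^sub>k\<close> the eigenspace is \<open>V \<times> L\<close>, where \<open>L\<close> is the
  eigenspace of \<open>\<Psi>\<^sub>k\<close>.  Writing a quaternion as \<open>q = a + b j\<close> with complex \<open>a\<close> and \<open>b\<close>, right
  multiplication by \<open>\<zeta>\<^sup>k\<close> is left multiplication by \<open>\<zeta>\<^sup>k\<close> on \<open>a\<close> and by the conjugate of \<open>\<zeta>\<^sup>k\<close> on \<open>b\<close>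
  (\<open>quat_intertwine_iff\<close>).  Hence \<open>L\<close> is zero unless \<open>k \<equiv> \<plusminus>r\<close>, and otherwise it is a free \<open>K\<close>-module
  of rank one (\<open>eigenspace_Psi\<close>).

  If \<open>L = 0\<close>, the inclusion \<open>P(V) \<rightarrow> P(V \<times> L)\<close> is a homeomorphism and its cone is contractible.  If \<open>L\<close>
  is a line with coordinate \<open>\<lambda>\<close>, the points \<open>[v, \<lambda>]\<close> outside \<open>P(V)\<close> have a unique affine coordinate
  \<open>\<lambda>\<^sup>-\<^sup>1 v\<close> in \<open>V\<close>, which tends to infinity near \<open>P(V)\<close>.  Stereographic projection therefore
  identifies the quotient of \<open>P(V \<times> L)\<close> by \<open>P(V)\<close> with the sphere of dimension \<open>dim V\<close>.

  It remains to compare the quotient with the mapping cone.  The subspace \<open>P(V)\<close> is the zero set of the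
  function \<open>u\<close> that is one minus the height of the image point on the sphere, and scaling down
  the coordinate \<open>\<lambda>\<close> deforms the region \<open>u \<le> 1\<close> into \<open>P(V)\<close>.  For every such neighbourhood deformation
  the cone is pointed homotopy equivalent to the quotient
  (\<open>neighbourhood_deformation.cofiber_sequence_collapse\<close>).  The two cases of the theorem are
  \<open>cofiber_sequence_trivial_extension\<close> and \<open>cofiber_sequence_line_extension\<close>.
\<close>

section \<open>Disjoint unions and added basepoints\<close>

lemma continuous_map_Inl: "continuous_map X (disjoint_union X Y) Inl"
proof -
  have "openin X {x \<in> topspace X. Inl x \<in> U}" if "openin (disjoint_union X Y) U" for U
  proof -
    have U: "openin X (Inl -` U)"
      using that by (simp only: openin_disjoint_union)
    moreover have "{x \<in> topspace X. Inl x \<in> U} = Inl -` U"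
      using openin_subset [OF U] by auto
    ultimately show ?thesis
      by simp
  qed
  then show ?thesis
    by (auto simp: continuous_map_def)
qed

lemma continuous_map_Inr: "continuous_map Y (disjoint_union X Y) Inr"
proof -
  have "openin Y {x \<in> topspace Y. Inr x \<in> U}" if "openin (disjoint_union X Y) U" for U
  proof -
    have U: "openin Y (Inr -` U)"
      using that by (simp only: openin_disjoint_union)
    moreover have "{x \<in> topspace Y. Inr x \<in> U} = Inr -` U"
      using openin_subset [OF U] by auto
    ultimately show ?thesis
      by simp
  qed
  then show ?thesis
    by (auto simp: continuous_map_def)
qed

lemma continuous_map_from_disjoint_union:
  assumes "continuous_map X T (F \<circ> Inl)" "continuous_map Y T (F \<circ> Inr)"
  shows "continuous_map (disjoint_union X Y) T F"
proof -
  have "openin (disjoint_union X Y) {z \<in> topspace (disjoint_union X Y). F z \<in> U}"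
    if "openin T U" for U
  proof -
    have "Inl -` {z \<in> topspace (disjoint_union X Y). F z \<in> U} = {x \<in> topspace X. (F \<circ> Inl) x \<in> U}"
      "Inr -` {z \<in> topspace (disjoint_union X Y). F z \<in> U} = {x \<in> topspace Y. (F \<circ> Inr) x \<in> U}"
      by auto
    then show ?thesis
      using openin_continuous_map_preimage [OF assms(1) that] openin_continuous_map_preimage [OF assms(2) that]
      by (simp only: openin_disjoint_union)
  qed
  moreover have "F \<in> topspace (disjoint_union X Y) \<rightarrow> topspace T"
    using assms by (auto simp: continuous_map_def)
  ultimately show ?thesis
    by (simp add: continuous_map_def)
qed

lemma continuous_map_map_sum:
  assumes "continuous_map X X' f" "continuous_map Y Y' g"
  shows "continuous_map (disjoint_union X Y) (disjoint_union X' Y') (map_sum f g)"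
proof (rule continuous_map_from_disjoint_union)
  show "continuous_map X (disjoint_union X' Y') (map_sum f g \<circ> Inl)"
    using continuous_map_compose [OF assms(1) continuous_map_Inl] by (simp add: o_def)
  show "continuous_map Y (disjoint_union X' Y') (map_sum f g \<circ> Inr)"
    using continuous_map_compose [OF assms(2) continuous_map_Inr] by (simp add: o_def)
qed

lemma vimage_image_Inl_Inr:
  "Inl -` (Inl ` S) = S" "Inr -` (Inr ` S) = S" "Inl -` (Inr ` S) = {}" "Inr -` (Inl ` S) = {}"
  by auto

lemma continuous_map_from_prod_disjoint_union:
  assumes l: "continuous_map (prod_topology Z X) T (\<lambda>(z, x). F (z, Inl x))"
    and r: "continuous_map (prod_topology Z Y) T (\<lambda>(z, y). F (z, Inr y))"
  shows "continuous_map (prod_topology Z (disjoint_union X Y)) T F"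
proof -
  have "openin (prod_topology Z (disjoint_union X Y))
          {p \<in> topspace (prod_topology Z (disjoint_union X Y)). F p \<in> U}" (is "openin _ ?S")
    if U: "openin T U" for U
    unfolding openin_prod_topology_alt
  proof (intro allI impI)
    fix z c assume zc: "(z, c) \<in> ?S"
    have ol: "openin (prod_topology Z X) {p \<in> topspace (prod_topology Z X). (\<lambda>(z, x). F (z, Inl x)) p \<in> U}"
      using l U by (rule openin_continuous_map_preimage)
    have or: "openin (prod_topology Z Y) {p \<in> topspace (prod_topology Z Y). (\<lambda>(z, x). F (z, Inr x)) p \<in> U}"
      using r U by (rule openin_continuous_map_preimage)
    show "\<exists>V W. openin Z V \<and> openin (disjoint_union X Y) W \<and> z \<in> V \<and> c \<in> W \<and> V \<times> W \<subseteq> ?S"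
    proof (cases c)
      case (Inl x)
      with zc ol obtain V W where VW: "openin Z V" "openin X W" "z \<in> V" "x \<in> W"
        "V \<times> W \<subseteq> {p \<in> topspace (prod_topology Z X). (\<lambda>(z, x). F (z, Inl x)) p \<in> U}"
        unfolding openin_prod_topology_alt by (auto 0 4)
      have "openin (disjoint_union X Y) (Inl ` W)"
        using VW by (simp add: openin_disjoint_union vimage_image_Inl_Inr)
      moreover have "V \<times> Inl ` W \<subseteq> ?S"
        using VW by (auto simp: subset_iff)
      ultimately show ?thesis
        using VW Inl by blast
    next
      case (Inr x)
      with zc or obtain V W where VW: "openin Z V" "openin Y W" "z \<in> V" "x \<in> W"
        "V \<times> W \<subseteq> {p \<in> topspace (prod_topology Z Y). (\<lambda>(z, x). F (z, Inr x)) p \<in> U}"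
        unfolding openin_prod_topology_alt by (auto 0 4)
      have "openin (disjoint_union X Y) (Inr ` W)"
        using VW by (simp add: openin_disjoint_union vimage_image_Inl_Inr)
      moreover have "V \<times> Inr ` W \<subseteq> ?S"
        using VW by (auto simp: subset_iff)
      ultimately show ?thesis
        using VW Inr by blast
    qed
  qed
  moreover have "F \<in> topspace (prod_topology Z (disjoint_union X Y)) \<rightarrow> topspace T"
    using continuous_map_funspace [OF l] continuous_map_funspace [OF r] by (auto simp: Pi_iff)
  ultimately show ?thesis
    by (simp add: continuous_map_def)
qed

lemma subtopology_disjoint_union:
  "subtopology (disjoint_union X Y) (S <+> T) = disjoint_union (subtopology X S) (subtopology Y T)"
proof -
  have "openin (subtopology (disjoint_union X Y) (S <+> T)) U \<longleftrightarrow>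
        openin (disjoint_union (subtopology X S) (subtopology Y T)) U" (is "?l \<longleftrightarrow> ?r") for U
  proof
    assume ?l
    then obtain O' where "openin (disjoint_union X Y) O'" "U = O' \<inter> (S <+> T)"
      unfolding openin_subtopology by blast
    moreover from this have "Inl -` U = Inl -` O' \<inter> S" "Inr -` U = Inr -` O' \<inter> T"
      by auto
    ultimately show ?r
      unfolding openin_disjoint_union openin_subtopology by blast
  next
    assume ?r
    then obtain P Q where PQ: "openin X P" "Inl -` U = P \<inter> S" "openin Y Q" "Inr -` U = Q \<inter> T"
      unfolding openin_disjoint_union openin_subtopology by blast
    have "Inl -` (P <+> Q) = P" "Inr -` (P <+> Q) = Q"
      by auto
    then have "openin (disjoint_union X Y) (P <+> Q)"
      using PQ by (simp only: openin_disjoint_union)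
    moreover have "U = (P <+> Q) \<inter> (S <+> T)"
    proof (rule Set.set_eqI)
      fix z show "z \<in> U \<longleftrightarrow> z \<in> (P <+> Q) \<inter> (S <+> T)"
        using PQ by (cases z) (auto simp: set_eq_iff)
    qed
    ultimately show ?l
      unfolding openin_subtopology by blast
  qed
  then show ?thesis
    by (simp add: topology_eq)
qed

lemma embedding_map_add_basepoint:
  assumes "embedding_map X Y f"
  shows "embedding_map (fst (add_basepoint X)) (fst (add_basepoint Y)) (map_sum f id)"
proof -
  let ?pt = "discrete_topology {()}"
  obtain f' where f': "homeomorphic_maps X (subtopology Y (f ` topspace X)) f f'"
    using assms unfolding embedding_map_def homeomorphic_map_maps by blast
  have im: "map_sum f id ` (topspace X <+> topspace ?pt) = f ` topspace X <+> topspace ?pt"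
    by (auto simp: image_iff Plus_def)
  have sub: "subtopology (disjoint_union Y ?pt) (f ` topspace X <+> topspace ?pt) =
      disjoint_union (subtopology Y (f ` topspace X)) ?pt"
    by (simp add: subtopology_disjoint_union)
  have "continuous_map (disjoint_union X ?pt) (disjoint_union (subtopology Y (f ` topspace X)) ?pt) (map_sum f id)"
    using f' by (intro continuous_map_map_sum) (auto simp: homeomorphic_maps_def)
  moreover have "continuous_map (disjoint_union (subtopology Y (f ` topspace X)) ?pt) (disjoint_union X ?pt) (map_sum f' id)"
    using f' by (intro continuous_map_map_sum) (auto simp: homeomorphic_maps_def)
  ultimately have "homeomorphic_maps (disjoint_union X ?pt)
     (disjoint_union (subtopology Y (f ` topspace X)) ?pt) (map_sum f id) (map_sum f' id)"
    using f' unfolding homeomorphic_maps_def by (auto simp: Plus_def)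
  then show ?thesis
    unfolding embedding_map_def add_basepoint_def fst_conv topspace_disjoint_union im sub
    by (auto simp: homeomorphic_map_maps)
qed

lemma compact_space_add_basepoint:
  assumes "compact_space X"
  shows "compact_space (fst (add_basepoint X))"
proof -
  let ?Y = "disjoint_union X (discrete_topology {()})"
  have "compactin ?Y (Inl ` topspace X)"
    using assms continuous_map_Inl unfolding compact_space_def by (rule image_compactin)
  moreover have "compactin ?Y (Inr ` {()})"
    by (rule image_compactin [OF _ continuous_map_Inr]) simp
  ultimately have "compactin ?Y (Inl ` topspace X \<union> Inr ` {()})"
    by (rule compactin_Un)
  then show ?thesis
    by (simp add: compact_space_def add_basepoint_def Plus_def)
qed

lemma topspace_add_basepoint:
  "topspace (fst (add_basepoint X)) = Inl ` topspace X \<union> {Inr ()}"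
  by (auto simp: add_basepoint_def Plus_def)

section \<open>Homotopy equivalences from collapsing maps\<close>

text \<open>
  The product of a quotient map with the identity is a quotient map because the interval is locally compact;
  homotopies on a quotient space can thus be defined upstairs.
\<close>

lemma quotient_map_interval_prod:
  assumes "quotient_map X Y q"
  shows "quotient_map (prod_topology (top_of_set {0..1::real}) X) (prod_topology (top_of_set {0..1}) Y)
           (\<lambda>(t, x). (t, q x))"
  using assms
  by (intro quotient_map_prod_right compact_imp_locally_compact_space)
    (auto simp: Hausdorff_space_subtopology compact_space_subtopology)

text \<open>
  The endpoints of the homotopy need to agree with \<open>p\<close> and \<open>q\<close> only on the space itself, provided that the
  side condition depends only on the values there.
\<close>

lemma homotopic_withI:
  assumes H: "continuous_map (prod_topology (top_of_set {0..1::real}) X) Y H"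
    and start: "\<And>x. x \<in> topspace X \<Longrightarrow> H (0, x) = p x"
    and stop: "\<And>x. x \<in> topspace X \<Longrightarrow> H (1, x) = q x"
    and P: "\<And>t. t \<in> {0..1} \<Longrightarrow> P (\<lambda>x. H (t, x))"
    and cong: "\<And>h k. (\<And>x. x \<in> topspace X \<Longrightarrow> h x = k x) \<Longrightarrow> P h \<longleftrightarrow> P k"
  shows "homotopic_with P X Y p q"
proof -
  have "homotopic_with P X Y p q \<longleftrightarrow>
      (\<exists>h. continuous_map (prod_topology (top_of_set {0..1::real}) X) Y h \<and>
        (\<forall>x\<in>topspace X. h (0, x) = p x) \<and> (\<forall>x\<in>topspace X. h (1, x) = q x) \<and>
        (\<forall>t\<in>{0..1}. P (\<lambda>x. h (t, x))))"
    by (rule homotopic_with, rule cong)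
  moreover have "\<forall>x\<in>topspace X. H (0, x) = p x" "\<forall>x\<in>topspace X. H (1, x) = q x"
      "\<forall>t\<in>{0..1}. P (\<lambda>x. H (t, x))"
    using start stop P by simp_all
  ultimately show ?thesis
    using H by blast
qed

text \<open>
  Suppose a homotopy from the identity to \<open>k\<close> respects the fibres of a quotient map \<open>h\<close>, and \<open>k\<close> is constant on these
  fibres.  Then \<open>k\<close> factors as \<open>h' \<circ> h\<close>, so that \<open>h' \<circ> h\<close> is homotopic to the identity, and the homotopy itself descends along \<open>h\<close> to
  one from the identity to \<open>h \<circ> h'\<close>.
\<close>

lemma homotopy_equivalence_of_collapse:
  assumes q: "quotient_map (fst C) (fst S) h"
    and c0: "snd C \<in> topspace (fst C)" "h (snd C) = snd S"
    and hom: "homotopic_with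
          (\<lambda>k. k (snd C) = snd C \<and>
               (\<forall>x\<in>topspace (fst C). \<forall>y\<in>topspace (fst C). h x = h y \<longrightarrow> h (k x) = h (k y)))
          (fst C) (fst C) id k"
    and k: "\<And>x y. \<lbrakk>x \<in> topspace (fst C); y \<in> topspace (fst C); h x = h y\<rbrakk> \<Longrightarrow> k x = k y"
  shows "pointed_homotopy_equivalence C S h"
proof -
  let ?I = "top_of_set {0..1::real}"
  have kc: "continuous_map (fst C) (fst C) k"
    using hom by (rule homotopic_with_imp_continuous_maps [THEN conjunct2])
  have k0: "k (snd C) = snd C"
    using homotopic_with_imp_property [OF hom] by blast
  have hc: "continuous_map (fst C) (fst S) h"
    by (simp add: q quotient_imp_continuous_map)
  obtain h' where h': "continuous_map (fst S) (fst C) h'"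
    "\<And>x. x \<in> topspace (fst C) \<Longrightarrow> h' (h x) = k x"
    by (rule quotient_map_lift_exists [OF q kc k]) auto
  have ph': "pointed_map S C h'"
    using h'(1) h'(2) [OF c0(1)] c0(2) k0 by (simp add: pointed_map_def)
  obtain H where H: "continuous_map (prod_topology ?I (fst C)) (fst C) H"
      "\<And>x. H (0, x) = x" "\<And>x. H (1, x) = k x"
    and P: "\<forall>t\<in>{0..1}. H (t, snd C) = snd C \<and>
          (\<forall>x\<in>topspace (fst C). \<forall>y\<in>topspace (fst C). h x = h y \<longrightarrow> h (H (t, x)) = h (H (t, y)))"
    using hom unfolding homotopic_with_def id_apply by (elim exE conjE) blast
  have HP: "\<And>t. t \<in> {0..1} \<Longrightarrow> H (t, snd C) = snd C"
      "\<And>t x y. \<lbrakk>t \<in> {0..1}; x \<in> topspace (fst C); y \<in> topspace (fst C); h x = h y\<rbrakk>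
          \<Longrightarrow> h (H (t, x)) = h (H (t, y))"
    using P by blast+
  have "pointed_homotopic C C k id"
    unfolding pointed_homotopic_def
    by (rule homotopic_with_symD) (rule homotopic_with_mono [OF hom], blast)
  moreover have "homotopic_with (\<lambda>h. h (snd C) = snd C) (fst C) (fst C) (h' \<circ> h) k"
    by (rule homotopic_with_equal)
      (use h'(2) [OF c0(1)] h'(2) k0 c0 continuous_map_compose [OF hc h'(1)] in auto)
  ultimately have 1: "pointed_homotopic C C (h' \<circ> h) id"
    unfolding pointed_homotopic_def by (rule homotopic_with_trans [rotated])
  let ?q = "\<lambda>(t, x). (t, h x)"
  obtain G where G: "continuous_map (prod_topology ?I (fst S)) (fst S) G"
    "\<And>p. p \<in> topspace (prod_topology ?I (fst C)) \<Longrightarrow> G (?q p) = (h \<circ> H) p"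
  proof (rule quotient_map_lift_exists [OF quotient_map_interval_prod [OF q]])
    show "continuous_map (prod_topology ?I (fst C)) (fst S) (h \<circ> H)"
      using H(1) hc by (rule continuous_map_compose)
    show "(h \<circ> H) p = (h \<circ> H) p'"
      if p: "p \<in> topspace (prod_topology ?I (fst C))" "p' \<in> topspace (prod_topology ?I (fst C))"
        and eq: "?q p = ?q p'" for p p'
    proof -
      obtain t x t' x' where "p = (t, x)" "p' = (t', x')"
        by (cases p, cases p') blast
      then show ?thesis
        using p eq HP(2) [of t x x'] by simp
    qed
  qed blast
  have surj: "h ` topspace (fst C) = topspace (fst S)"
    by (rule quotient_imp_surjective_map [OF q])
  have sS: "snd S \<in> topspace (fst S)"
    using imageI [OF c0(1), of h] c0(2) surj by simp
  have "homotopic_with (\<lambda>k. k (snd S) = snd S) (fst S) (fst S) id (h \<circ> h')"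
  proof (rule homotopic_withI [OF G(1)])
    fix y assume "y \<in> topspace (fst S)"
    then have "y \<in> h ` topspace (fst C)"
      by (simp only: surj)
    then obtain x where x: "x \<in> topspace (fst C)" "y = h x"
      by (rule imageE)
    show "G (0, y) = id y"
      using G(2) [of "(0, x)"] x H(2) [of x] by simp
    show "G (1, y) = (h \<circ> h') y"
      using G(2) [of "(1, x)"] x H(3) [of x] h'(2) [of x] by simp
  next
    show "G (t, snd S) = snd S" if "t \<in> {0..1}" for t
      using G(2) [of "(t, snd C)"] that c0 HP(1) [OF that] by simp
  qed (simp add: sS)
  then have 2: "pointed_homotopic S S (h \<circ> h') id"
    unfolding pointed_homotopic_def by (rule homotopic_with_symD)
  show ?thesis
    unfolding pointed_homotopy_equivalence_def
    using 1 2 ph' hc c0 by (auto simp: pointed_map_def [of C])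
qed

section \<open>The cone of a neighbourhood deformation retract\<close>

text \<open>
  A form of neighbourhood deformation retract: \<open>u\<close> vanishes exactly on the image of \<open>A\<close>, and \<open>D\<close> deforms
  \<open>X\<close>, keeping that image fixed, until the region \<open>u \<le> 1\<close> lies in it.
\<close>

locale neighbourhood_deformation =
  fixes A :: "'a pointed" and f :: "'a \<Rightarrow> 'b" and X :: "'b pointed"
    and u :: "'b \<Rightarrow> real" and D :: "real \<times> 'b \<Rightarrow> 'b"
  assumes embedding: "embedding_map (fst A) (fst X) f"
    and basepoint: "snd A \<in> topspace (fst A)" "f (snd A) = snd X"
    and u_continuous: "continuous_map (fst X) euclideanreal u"
    and u_nonneg: "\<And>x. x \<in> topspace (fst X) \<Longrightarrow> 0 \<le> u x"
    and u_eq_0_iff: "\<And>x. x \<in> topspace (fst X) \<Longrightarrow> u x = 0 \<longleftrightarrow> x \<in> f ` topspace (fst A)"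
    and D_continuous: "continuous_map (prod_topology (top_of_set {0..1}) (fst X)) (fst X) D"
    and D_start: "\<And>x. x \<in> topspace (fst X) \<Longrightarrow> D (0, x) = x"
    and D_fixes: "\<And>t a. \<lbrakk>t \<in> {0..1}; a \<in> topspace (fst A)\<rbrakk> \<Longrightarrow> D (t, f a) = f a"
    and D_end: "\<And>x. \<lbrakk>x \<in> topspace (fst X); u x \<le> 1\<rbrakk> \<Longrightarrow> D (1, x) \<in> f ` topspace (fst A)"
begin

abbreviation "\<I> \<equiv> top_of_set {0..1::real}"

abbreviation "cone_source \<equiv> disjoint_union (fst X) (prod_topology (fst A) \<I>)"

abbreviation "cl \<equiv> cone_class A f X"

abbreviation "Cone \<equiv> mapping_cone A f X"

text \<open>
  The image of the cone on \<open>A\<close> in the mapping cone, including its base \<open>f(A)\<close>.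
\<close>

definition collapsed :: "('b + 'a \<times> real) set" where
  "collapsed = Inl ` {x \<in> topspace (fst X). u x = 0} \<union> {c \<in> topspace (fst Cone). \<exists>p. c = Inr p}"

lemma quotient_map_cl: "quotient_map cone_source (fst Cone) cl"
  by (simp add: mapping_cone_def quotient_map_quotient_topology)

lemma continuous_map_f: "continuous_map (fst A) (fst X) f"
  using embedding unfolding embedding_map_def
  by (meson continuous_map_in_subtopology homeomorphic_imp_continuous_map)

lemma f_in: "a \<in> topspace (fst A) \<Longrightarrow> f a \<in> topspace (fst X)"
  using continuous_map_image_subset_topspace [OF continuous_map_f]
  by blast

lemma u_f: "a \<in> topspace (fst A) \<Longrightarrow> u (f a) = 0"
  using u_eq_0_iff f_in by blast

lemma Inl_in_Cone: "x \<in> topspace (fst X) \<Longrightarrow> Inl x \<in> topspace (fst Cone)"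
  by (force simp: mapping_cone_def image_iff)

lemma cl_in_collapsed:
  assumes "a \<in> topspace (fst A)" "t \<in> {0..1}"
  shows "cl (Inr (a, t)) \<in> collapsed"
proof -
  have "cl (Inr (a, t)) \<in> topspace (fst Cone)"
    unfolding mapping_cone_def using assms by (auto simp del: cone_class.simps intro!: imageI)
  moreover have "snd X \<in> topspace (fst X)" "u (snd X) = 0"
    using u_f f_in basepoint by metis+
  ultimately show ?thesis
    using assms u_f f_in by (auto simp: collapsed_def)
qed

lemma Cone_cases [consumes 1]:
  assumes "c \<in> topspace (fst Cone)"
  obtains x where "x \<in> topspace (fst X)" "c = Inl x"
  | a t where "a \<in> topspace (fst A)" "t \<in> {0..1}" "c = Inr (a, t)" "t \<noteq> 0" "t \<noteq> 1" "a \<noteq> snd A"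
  using assms basepoint f_in by (force simp: mapping_cone_def split: if_splits)

text \<open>
  Homotopies on the mapping cone are continuous if they are so on \<open>X\<close> and on the uncollapsed cylinder over \<open>A\<close>.
\<close>

lemma continuous_map_from_homotopy_Cone:
  assumes "continuous_map (prod_topology \<I> (fst X)) T (\<lambda>(t, x). F (t, Inl x))"
    and "continuous_map (prod_topology \<I> (prod_topology (fst A) \<I>)) T (\<lambda>(t, p). F (t, cl (Inr p)))"
  shows "continuous_map (prod_topology \<I> (fst Cone)) T F"
proof (rule continuous_compose_quotient_map [OF quotient_map_interval_prod [OF quotient_map_cl]])
  show "continuous_map (prod_topology \<I> cone_source) T (F \<circ> (\<lambda>(t, x). (t, cl x)))"
    by (rule continuous_map_from_prod_disjoint_union) (use assms in \<open>simp_all add: case_prod_unfold\<close>)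
qed

lemma continuous_map_cl_Inl: "continuous_map (fst X) (fst Cone) Inl"
proof -
  have "continuous_map (fst X) (fst Cone) (cl \<circ> Inl)"
    by (rule continuous_map_compose [OF continuous_map_Inl quotient_imp_continuous_map [OF quotient_map_cl]])
  then show ?thesis
    by (simp add: o_def)
qed

lemma continuous_map_cl_Inr: "continuous_map (prod_topology (fst A) \<I>) (fst Cone) (\<lambda>p. cl (Inr p))"
  using continuous_map_compose [OF continuous_map_Inr quotient_imp_continuous_map [OF quotient_map_cl]]
  by (simp add: o_def)

text \<open>
  The identity of the mapping cone is deformed in two stages, both of which map the cone on \<open>A\<close> into
  itself.  First, \<open>squeeze\<close> performs the deformation \<open>D\<close> on \<open>X\<close> and leaves the cone alone.  Then \<open>push\<close> slides
  each point of the cone towards the tip; a point \<open>x\<close> of \<open>X\<close> with \<open>u x \<le> 1\<close>, which by now lies in \<open>A\<close>, is dragged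
  to the height \<open>u x\<close> of the cone.  At the end the whole cone on \<open>A\<close> sits at the tip.  Using two stages avoids dividing by
  \<open>u\<close>.
\<close>

definition squeeze :: "real \<times> ('b + 'a \<times> real) \<Rightarrow> 'b + 'a \<times> real" where
  "squeeze = (\<lambda>(t, c). case c of Inl x \<Rightarrow> Inl (D (t, x)) | Inr p \<Rightarrow> Inr p)"

definition f_inv :: "'b \<Rightarrow> 'a" where
  "f_inv = inv_into (topspace (fst A)) f"

definition push :: "real \<times> ('b + 'a \<times> real) \<Rightarrow> 'b + 'a \<times> real" where
  "push = (\<lambda>(t, c). case c of
     Inl x \<Rightarrow> (if u x \<le> 1 then cl (Inr (f_inv (D (1, x)), 1 - t * (1 - u x))) else Inl (D (1, x)))
   | Inr (a, s) \<Rightarrow> cl (Inr (a, s * (1 - t))))"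

lemma f_inv_f: "a \<in> topspace (fst A) \<Longrightarrow> f_inv (f a) = a"
  using embedding unfolding f_inv_def embedding_map_def
  by (metis homeomorphic_imp_injective_map inv_into_f_f)

lemma f_f_inv: "x \<in> f ` topspace (fst A) \<Longrightarrow> f (f_inv x) = x"
  unfolding f_inv_def by (rule f_inv_into_f)

lemma f_inv_in: "x \<in> f ` topspace (fst A) \<Longrightarrow> f_inv x \<in> topspace (fst A)"
  unfolding f_inv_def by (rule inv_into_into)

lemma continuous_map_f_inv: "continuous_map (subtopology (fst X) (f ` topspace (fst A))) (fst A) f_inv"
proof -
  obtain g where g: "homeomorphic_maps (fst A) (subtopology (fst X) (f ` topspace (fst A))) f g"
    using embedding unfolding embedding_map_def homeomorphic_map_maps by blast
  show ?thesis
  proof (rule continuous_map_eq)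
    show "continuous_map (subtopology (fst X) (f ` topspace (fst A))) (fst A) g"
      using g by (simp add: homeomorphic_maps_def)
    show "g x = f_inv x" if "x \<in> topspace (subtopology (fst X) (f ` topspace (fst A)))" for x
      using that g f_inv_f by (auto simp: homeomorphic_maps_def)
  qed
qed

lemma D_basepoint: "t \<in> {0..1} \<Longrightarrow> D (t, snd X) = snd X"
  using D_fixes basepoint by metis

lemma continuous_map_squeeze: "continuous_map (prod_topology \<I> (fst Cone)) (fst Cone) squeeze"
proof (rule continuous_map_from_homotopy_Cone)
  show "continuous_map (prod_topology \<I> (fst X)) (fst Cone) (\<lambda>(t, x). squeeze (t, Inl x))"
    using continuous_map_compose [OF D_continuous continuous_map_cl_Inl]
    by (simp add: squeeze_def o_def case_prod_unfold)
  have "continuous_map (prod_topology \<I> (prod_topology (fst A) \<I>)) (fst Cone) (\<lambda>z. cl (Inr (snd z)))"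
    using continuous_map_compose [OF continuous_map_snd continuous_map_cl_Inr] by (simp add: o_def)
  then show "continuous_map (prod_topology \<I> (prod_topology (fst A) \<I>)) (fst Cone)
      (\<lambda>(t, p). squeeze (t, cl (Inr p)))"
    by (rule continuous_map_eq) (auto simp: squeeze_def D_fixes D_basepoint)
qed

text \<open>
  The two formulas on \<open>X\<close> agree where \<open>u = 1\<close>, since the end of the cylinder at height 1 is glued to \<open>f(A)\<close>.
\<close>

lemma continuous_map_push: "continuous_map (prod_topology \<I> (fst Cone)) (fst Cone) push"
proof (rule continuous_map_from_homotopy_Cone)
  let ?IX = "prod_topology \<I> (fst X)"
  have uc: "continuous_map ?IX euclideanreal (\<lambda>p. u (snd p))"
    using continuous_map_compose [OF continuous_map_snd u_continuous] by (simp add: o_def)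
  have tc: "continuous_map ?IX euclideanreal fst"
    using continuous_map_fst [of \<I> "fst X"] by (simp add: continuous_map_in_subtopology)
  have D1: "continuous_map ?IX (fst X) (\<lambda>p. D (1, snd p))"
    by (rule continuous_map_compose [OF _ D_continuous, unfolded o_def])
      (auto intro!: continuous_map_pairedI continuous_map_snd)
  have "continuous_map ?IX (fst Cone)
      (\<lambda>p. if u (snd p) \<le> 1 then cl (Inr (f_inv (D (1, snd p)), 1 - fst p * (1 - u (snd p)))) else Inl (D (1, snd p)))"
  proof (rule continuous_map_cases_le [where q = "\<lambda>_. 1", OF uc])
    let ?S = "subtopology ?IX {p \<in> topspace ?IX. u (snd p) \<le> 1}"
    have "continuous_map ?S (subtopology (fst X) (f ` topspace (fst A))) (\<lambda>p. D (1, snd p))"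
      using D_end by (auto simp: continuous_map_in_subtopology intro: continuous_map_from_subtopology [OF D1])
    then have "continuous_map ?S (fst A) (\<lambda>p. f_inv (D (1, snd p)))"
      by (rule continuous_map_compose [OF _ continuous_map_f_inv, unfolded o_def])
    moreover have "continuous_map ?S \<I> (\<lambda>p. 1 - fst p * (1 - u (snd p)))"
      unfolding continuous_map_in_subtopology
    proof
      show "continuous_map ?S euclideanreal (\<lambda>p. 1 - fst p * (1 - u (snd p)))"
        by (intro continuous_intros continuous_map_from_subtopology uc tc)
      show "(\<lambda>p. 1 - fst p * (1 - u (snd p))) \<in> topspace ?S \<rightarrow> {0..1}"
        by (auto simp: u_nonneg mult_le_one)
    qed
    ultimately have "continuous_map ?S (prod_topology (fst A) \<I>)
        (\<lambda>p. (f_inv (D (1, snd p)), 1 - fst p * (1 - u (snd p))))"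
      by (rule continuous_map_pairedI)
    then show "continuous_map ?S (fst Cone) (\<lambda>p. cl (Inr (f_inv (D (1, snd p)), 1 - fst p * (1 - u (snd p)))))"
      by (rule continuous_map_compose [OF _ continuous_map_cl_Inr, unfolded o_def])
  next
    show "continuous_map (subtopology ?IX {p \<in> topspace ?IX. 1 \<le> u (snd p)}) (fst Cone)
        (\<lambda>p. Inl (D (1, snd p)))"
      by (intro continuous_map_from_subtopology continuous_map_compose [OF D1 continuous_map_cl_Inl, unfolded o_def])
  next
    fix p assume "p \<in> topspace ?IX" "u (snd p) = 1"
    then have "D (1, snd p) \<in> f ` topspace (fst A)"
      using D_end by auto
    then show "cl (Inr (f_inv (D (1, snd p)), 1 - fst p * (1 - u (snd p)))) = Inl (D (1, snd p))"
      using \<open>u (snd p) = 1\<close> f_f_inv basepoint by force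
  qed auto
  then show "continuous_map ?IX (fst Cone) (\<lambda>(t, x). push (t, Inl x))"
    by (rule continuous_map_eq) (auto simp: push_def simp del: cone_class.simps)
next
  let ?IAI = "prod_topology \<I> (prod_topology (fst A) \<I>)"
  have tc: "continuous_map ?IAI euclideanreal fst"
    using continuous_map_fst [of \<I> "prod_topology (fst A) \<I>"] by (simp add: continuous_map_in_subtopology)
  have sc: "continuous_map ?IAI euclideanreal (\<lambda>z. snd (snd z))"
    using continuous_map_compose [OF continuous_map_snd continuous_map_snd, of \<I> "fst A" \<I>]
    by (simp add: o_def continuous_map_in_subtopology)
  have "continuous_map ?IAI (prod_topology (fst A) \<I>) (\<lambda>z. (fst (snd z), snd (snd z) * (1 - fst z)))"
  proof (rule continuous_map_pairedI)
    show "continuous_map ?IAI (fst A) (\<lambda>z. fst (snd z))"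
      using continuous_map_compose [OF continuous_map_snd continuous_map_fst] by (simp add: o_def)
    show "continuous_map ?IAI \<I> (\<lambda>z. snd (snd z) * (1 - fst z))"
      unfolding continuous_map_in_subtopology
      by (intro conjI continuous_intros tc sc) (auto simp: mult_le_one)
  qed
  then have "continuous_map ?IAI (fst Cone) (\<lambda>z. cl (Inr (fst (snd z), snd (snd z) * (1 - fst z))))"
    by (rule continuous_map_compose [OF _ continuous_map_cl_Inr, unfolded o_def])
  then show "continuous_map ?IAI (fst Cone) (\<lambda>(t, p). push (t, cl (Inr p)))"
  proof (rule continuous_map_eq)
    fix z assume "z \<in> topspace ?IAI"
    then obtain t a s where z: "z = (t, a, s)" "t \<in> {0..1}" "a \<in> topspace (fst A)" "s \<in> {0..1}"
      by auto
    have "push (t, Inl (f a)) = cl (Inr (a, 1 - t))"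
      using z by (simp add: push_def u_f D_fixes f_inv_f)
    moreover from this have "push (t, Inl (snd X)) = Inl (snd X)"
      using z f_inv_f [OF basepoint(1)] basepoint u_f [OF basepoint(1)] D_basepoint
      by (simp add: push_def)
    ultimately show "cl (Inr (fst (snd z), snd (snd z) * (1 - fst z))) =
        (case z of (t, p) \<Rightarrow> push (t, cl (Inr p)))"
      using z by (auto simp: push_def)
  qed
qed

lemma squeeze_collapsed: "t \<in> {0..1} \<Longrightarrow> c \<in> collapsed \<Longrightarrow> squeeze (t, c) \<in> collapsed"
  using u_eq_0_iff D_fixes by (auto simp: collapsed_def squeeze_def)

lemma push_collapsed:
  assumes t: "t \<in> {0..1}" and c: "c \<in> collapsed"
  shows "push (t, c) \<in> collapsed"
proof -
  have "c \<in> topspace (fst Cone)"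
    using c Inl_in_Cone by (auto simp: collapsed_def)
  then show ?thesis
  proof (cases rule: Cone_cases)
    case (1 x)
    then have "u x = 0"
      using c by (auto simp: collapsed_def)
    moreover have "f_inv (D (1, x)) \<in> topspace (fst A)"
      using 1 D_end f_inv_in \<open>u x = 0\<close> by auto
    ultimately show ?thesis
      using 1 t by (auto simp: push_def simp del: cone_class.simps intro!: cl_in_collapsed)
  next
    case (2 a s)
    then show ?thesis
      using t by (auto simp: push_def mult_le_one simp del: cone_class.simps intro!: cl_in_collapsed)
  qed
qed

text \<open>
  If \<open>g\<close> is a quotient map that collapses exactly \<open>f(A)\<close>, then \<open>g\<close> on \<open>X\<close> and the basepoint on
  the cone give a quotient map \<open>h\<close> on the mapping cone whose only nontrivial fibre is the cone on \<open>A\<close>.  The two-stage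
  deformation preserves this fibre and finally sends it to the tip, so \<open>h\<close> is a homotopy equivalence.
\<close>

lemma cofiber_sequence_collapse:
  fixes S :: "'c pointed"
  assumes g: "quotient_map (fst X) (fst S) g"
    and gA: "\<And>x. \<lbrakk>x \<in> topspace (fst X); u x = 0\<rbrakk> \<Longrightarrow> g x = snd S"
    and inj: "\<And>x y. \<lbrakk>x \<in> topspace (fst X); y \<in> topspace (fst X); g x = g y\<rbrakk>
        \<Longrightarrow> x = y \<or> u x = 0 \<and> u y = 0"
  shows "cofiber_sequence A f X g S"
proof -
  define h where "h = (\<lambda>c :: 'b + 'a \<times> real. case c of Inl x \<Rightarrow> g x | Inr p \<Rightarrow> snd S)"
  have xX: "snd X \<in> topspace (fst X)"
    using basepoint f_in by metis
  have gX: "g (snd X) = snd S"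
    using gA xX basepoint u_f by metis
  have sS: "snd S \<in> topspace (fst S)"
    using g gX xX by (metis imageI quotient_imp_surjective_map)
  have h_collapsed: "h c = snd S" if "c \<in> collapsed" for c
    using that gA by (auto simp: collapsed_def h_def)
  have h_eq: "c = d \<or> c \<in> collapsed \<and> d \<in> collapsed"
    if "c \<in> topspace (fst Cone)" "d \<in> topspace (fst Cone)" "h c = h d" for c d
  proof -
    have s: "u x = 0" if "x \<in> topspace (fst X)" "g x = snd S" for x
      using inj [of x "snd X"] that xX gX u_f basepoint by metis
    show ?thesis
      using that(1)
    proof (cases rule: Cone_cases)
      case (1 x)
      show ?thesis
        using that(2) by (cases rule: Cone_cases) (use 1 that s inj in \<open>auto simp: h_def collapsed_def\<close>)
    next
      case (2 a t)
      show ?thesis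
        using that(2) by (cases rule: Cone_cases) (use 2 that s in \<open>auto simp: h_def collapsed_def\<close>)
    qed
  qed
  have hc: "continuous_map (fst Cone) (fst S) h"
  proof (rule continuous_compose_quotient_map [OF quotient_map_cl],
      rule continuous_map_from_disjoint_union)
    show "continuous_map (fst X) (fst S) (h \<circ> cl \<circ> Inl)"
      using quotient_imp_continuous_map [OF g] by (simp add: h_def o_def)
    have "continuous_map (prod_topology (fst A) \<I>) (fst S) (\<lambda>p. snd S)"
      using sS by simp
    then show "continuous_map (prod_topology (fst A) \<I>) (fst S) (h \<circ> cl \<circ> Inr)"
      by (rule continuous_map_eq) (auto simp: h_def gX gA u_f f_in)
  qed
  have hq: "quotient_map (fst Cone) (fst S) h"
    by (rule quotient_map_from_composition [OF continuous_map_cl_Inl hc])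
      (use g in \<open>simp add: o_def h_def\<close>)
  have tip: "snd Cone = Inl (snd X)"
    by (simp add: mapping_cone_def)
  define P where "P = (\<lambda>k. k (snd Cone) = snd Cone \<and>
      (\<forall>c\<in>topspace (fst Cone). \<forall>d\<in>topspace (fst Cone). h c = h d \<longrightarrow> h (k c) = h (k d)))"
  have P_if: "P k" if "k (snd Cone) = snd Cone" "\<And>c. c \<in> collapsed \<Longrightarrow> k c \<in> collapsed" for k
    unfolding P_def using that h_eq h_collapsed by metis
  have P_cong: "P k \<longleftrightarrow> P l" if "\<And>x. x \<in> topspace (fst Cone) \<Longrightarrow> k x = l x" for k l
    unfolding P_def using that xX by (simp add: tip Inl_in_Cone)
  have push_tip: "push (t, snd Cone) = snd Cone" if "t \<in> {0..1}" for t
    using that basepoint f_inv_f [OF basepoint(1)] u_f [OF basepoint(1)] D_basepoint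
    by (simp add: push_def tip)
  have "homotopic_with P (fst Cone) (fst Cone) id (\<lambda>c. squeeze (1, c))"
  proof (rule homotopic_withI [OF continuous_map_squeeze _ _ _ P_cong])
    show "squeeze (0, c) = id c" if "c \<in> topspace (fst Cone)" for c
      using that by (cases rule: Cone_cases) (auto simp: squeeze_def D_start)
    show "P (\<lambda>c. squeeze (t, c))" if "t \<in> {0..1}" for t
      by (rule P_if) (use that squeeze_collapsed D_basepoint in \<open>auto simp: tip squeeze_def\<close>)
  qed auto
  moreover have "homotopic_with P (fst Cone) (fst Cone) (\<lambda>c. squeeze (1, c)) (\<lambda>c. push (1, c))"
  proof (rule homotopic_withI [OF continuous_map_push _ _ _ P_cong])
    show "push (0, c) = squeeze (1, c)" if "c \<in> topspace (fst Cone)" for c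
      using that
    proof (cases rule: Cone_cases)
      case (1 x)
      show ?thesis
      proof (cases "u x \<le> 1")
        case True
        then show ?thesis
          using 1 D_end [of x] f_f_inv [of "D (1, x)"] basepoint by (auto simp: push_def squeeze_def)
      qed (simp add: 1 push_def squeeze_def)
    qed (auto simp: push_def squeeze_def)
    show "P (\<lambda>c. push (t, c))" if "t \<in> {0..1}" for t
      by (rule P_if) (use that push_collapsed push_tip in auto)
  qed auto
  ultimately have hom: "homotopic_with P (fst Cone) (fst Cone) id (\<lambda>c. push (1, c))"
    by (rule homotopic_with_trans)
  have collapse: "push (1, c) = Inl (snd X)" if "c \<in> collapsed" for c
    using that by (auto simp: collapsed_def push_def)
  have "pointed_homotopy_equivalence Cone S h"
  proof (rule homotopy_equivalence_of_collapse [OF hq _ _ hom [unfolded P_def]])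
    show "push (1, c) = push (1, d)"
      if "c \<in> topspace (fst Cone)" "d \<in> topspace (fst Cone)" "h c = h d" for c d
      using h_eq [OF that] collapse by metis
  qed (auto simp: tip h_def gX Inl_in_Cone xX)
  moreover have "pointed_homotopic X S (h \<circ> Inl) g"
    using quotient_imp_continuous_map [OF g] gX
    by (simp add: pointed_homotopic_def h_def o_def)
  moreover have "pointed_map A X f"
    using continuous_map_f basepoint by (simp add: pointed_map_def)
  moreover have "pointed_map X S g"
    using quotient_imp_continuous_map [OF g] gX by (simp add: pointed_map_def)
  ultimately show ?thesis
    unfolding cofiber_sequence_def by blast
qed

end

section \<open>Stereographic projection of a subspace\<close>

text \<open>
  The index 0 is left free for the height of a point of the sphere; outside \<open>{1..dim V}\<close> the vectors are zero, to match the vanishing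
  of the higher coordinates of \<open>nsphere\<close>.
\<close>

lemma orthonormal_coordinates:
  fixes V :: "'a::euclidean_space set"
  assumes V: "subspace V"
  obtains e :: "nat \<Rightarrow> 'a" where
    "\<And>i. e i \<in> V" "\<And>i. norm (e i) \<le> 1"
    "\<And>i j. \<lbrakk>i \<in> {1..dim V}; j \<in> {1..dim V}\<rbrakk> \<Longrightarrow> e i \<bullet> e j = (if i = j then 1 else 0)"
    "\<And>i. i \<notin> {1..dim V} \<Longrightarrow> e i = 0"
    "\<And>v. v \<in> V \<Longrightarrow> (\<Sum>i=1..dim V. (v \<bullet> e i) *\<^sub>R e i) = v"
    "\<And>v. v \<in> V \<Longrightarrow> (\<Sum>i=1..dim V. (v \<bullet> e i)\<^sup>2) = (norm v)\<^sup>2"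
proof -
  obtain B where B: "B \<subseteq> V" "pairwise orthogonal B" "\<And>x. x \<in> B \<Longrightarrow> norm x = 1"
      "independent B" "card B = dim V" "span B = V"
    using orthonormal_basis_subspace [OF V] by metis
  have fin: "finite B"
    using B(4) by (rule independent_imp_finite)
  obtain h where h: "bij_betw h {1..dim V} B"
    using ex_bij_betw_nat_finite_1 [OF fin] B(5) by auto
  define e where "e i = (if i \<in> {1..dim V} then h i else 0)" for i
  have hB: "h i \<in> B" if "i \<in> {1..dim V}" for i
    using bij_betwE [OF h] that by blast
  have orth: "e i \<bullet> e j = (if i = j then 1 else 0)" if "i \<in> {1..dim V}" "j \<in> {1..dim V}" for i j
  proof (cases "i = j")
    case True
    then show ?thesis
      using B(3) [OF hB [OF that(1)]] that by (simp add: e_def norm_eq_1)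
  next
    case False
    then have "h i \<noteq> h j"
      using h that by (auto simp: bij_betw_def inj_on_def)
    then show ?thesis
      using pairwiseD [OF B(2) hB [OF that(1)] hB [OF that(2)]] that False
      by (simp add: e_def orthogonal_def)
  qed
  have expand: "(\<Sum>i=1..dim V. (v \<bullet> e i) *\<^sub>R e i) = v" if "v \<in> V" for v
  proof -
    have "(\<Sum>i=1..dim V. (v \<bullet> e i) *\<^sub>R e i) = (\<Sum>i=1..dim V. (v \<bullet> h i) *\<^sub>R h i)"
      by (rule sum.cong) (auto simp: e_def)
    also have "\<dots> = (\<Sum>b\<in>B. (v \<bullet> b) *\<^sub>R b)"
      by (rule sum.reindex_bij_betw [OF h])
    also have "\<dots> = v"
      using B fin that by (intro orthonormal_basis_expand) auto
    finally show ?thesis .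
  qed
  have "(\<Sum>i=1..dim V. (v \<bullet> e i)\<^sup>2) = (norm v)\<^sup>2" if "v \<in> V" for v
  proof -
    have "(norm v)\<^sup>2 = v \<bullet> (\<Sum>i=1..dim V. (v \<bullet> e i) *\<^sub>R e i)"
      using expand [OF that] by (simp add: power2_norm_eq_inner)
    also have "\<dots> = (\<Sum>i=1..dim V. (v \<bullet> e i)\<^sup>2)"
      by (simp add: inner_sum_right power2_eq_square)
    finally show ?thesis ..
  qed
  moreover have "e i \<in> V" "norm (e i) \<le> 1" for i
    using hB [of i] B(1,3) subspace_0 [OF V] by (auto simp: e_def)
  moreover have "e i = 0" if "i \<notin> {1..dim V}" for i
    using that by (simp only: e_def if_False)
  ultimately show thesis
    by (intro that [of e] orth expand)
qed

text \<open>
  The inverse of stereographic projection from \<open>sphere_point\<close>.  The bound says that \<open>\<sigma> v\<close> tends to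
  \<open>sphere_point\<close>, the point at infinity, as \<open>v\<close> grows.
\<close>

lemma stereographic_projection:
  fixes V :: "'a::euclidean_space set"
  assumes V: "subspace V"
  obtains \<sigma> :: "'a \<Rightarrow> nat \<Rightarrow> real" where
    "\<And>i. continuous_on UNIV (\<lambda>v. \<sigma> v i)"
    "bij_betw \<sigma> V (topspace (nsphere (dim V)) - {sphere_point})"
    "\<And>v i. v \<noteq> 0 \<Longrightarrow> \<bar>\<sigma> v i - sphere_point i\<bar> \<le> 2 / norm v"
    "\<And>v. \<sigma> v 0 = 1 - 2 / ((norm v)\<^sup>2 + 1)"
proof -
  let ?m = "dim V"
  obtain e where e: "\<And>i. e i \<in> V" "\<And>i. norm (e i) \<le> 1"
    "\<And>i j. \<lbrakk>i \<in> {1..?m}; j \<in> {1..?m}\<rbrakk> \<Longrightarrow> e i \<bullet> e j = (if i = j then 1 else 0)"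
    "\<And>i. i \<notin> {1..?m} \<Longrightarrow> e i = 0"
    "\<And>v. v \<in> V \<Longrightarrow> (\<Sum>i=1..?m. (v \<bullet> e i) *\<^sub>R e i) = v"
    "\<And>v. v \<in> V \<Longrightarrow> (\<Sum>i=1..?m. (v \<bullet> e i)\<^sup>2) = (norm v)\<^sup>2"
    by (rule orthonormal_coordinates [OF V], rule that)
  define \<sigma> where "\<sigma> v i = (if i = 0 then 1 - 2 / ((norm v)\<^sup>2 + 1) else 2 * (v \<bullet> e i) / ((norm v)\<^sup>2 + 1))"
    for v :: 'a and i :: nat
  have pos: "(norm v)\<^sup>2 + 1 > 0" for v :: 'a
    by (simp add: add_nonneg_pos)
  have nz: "(norm v)\<^sup>2 + 1 \<noteq> 0" for v :: 'a
    using pos [of v] by simp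
  have split: "(\<Sum>i\<le>?m. f i) = f 0 + (\<Sum>i=1..?m. f i)" for f :: "nat \<Rightarrow> real"
  proof -
    have "{..?m} = insert 0 {1..?m}"
      by auto
    then show ?thesis
      by simp
  qed
  have mem: "\<sigma> v \<in> topspace (nsphere ?m) - {sphere_point}" if "v \<in> V" for v
  proof -
    let ?d = "(norm v)\<^sup>2 + 1"
    have "(\<Sum>i=1..?m. (\<sigma> v i)\<^sup>2) = (\<Sum>i=1..?m. (2 / ?d)\<^sup>2 * (v \<bullet> e i)\<^sup>2)"
      by (rule sum.cong) (auto simp: \<sigma>_def power_divide power_mult_distrib)
    also have "\<dots> = (2 / ?d)\<^sup>2 * (norm v)\<^sup>2"
      using e(6) [OF that] by (simp flip: sum_distrib_left)
    finally have "(\<Sum>i\<le>?m. (\<sigma> v i)\<^sup>2) = (1 - 2 / ?d)\<^sup>2 + (2 / ?d)\<^sup>2 * (?d - 1)"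
      unfolding split by (simp add: \<sigma>_def)
    also have "\<dots> = 1 - 2 * (2 / ?d) + (2 / ?d) * ((2 / ?d) * ?d)"
      by algebra
    also have "(2 / ?d) * ?d = 2"
      using nz [of v] by (metis nonzero_eq_divide_eq)
    finally have "(\<Sum>i\<le>?m. (\<sigma> v i)\<^sup>2) = 1 - 2 * (2 / ?d) + (2 / ?d) * 2" .
    also have "\<dots> = 1"
      by simp
    finally have "(\<Sum>i\<le>?m. (\<sigma> v i)\<^sup>2) = 1" .
    moreover have "\<sigma> v i = 0" if "i > ?m" for i
      using that e(4) [of i] by (simp add: \<sigma>_def)
    moreover have "\<sigma> v 0 \<noteq> sphere_point 0"
      using nz [of v] by (simp add: \<sigma>_def sphere_point_def)
    ultimately show ?thesis
      by (auto simp: nsphere)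
  qed
  have inj: "v = w" if "v \<in> V" "w \<in> V" "\<sigma> v = \<sigma> w" for v w
  proof -
    have "2 / ((norm v)\<^sup>2 + 1) = 2 / ((norm w)\<^sup>2 + 1)"
      using fun_cong [OF that(3), of 0] by (simp add: \<sigma>_def)
    then have d: "(norm v)\<^sup>2 + 1 = (norm w)\<^sup>2 + 1"
      using nz [of v] nz [of w] by (simp add: frac_eq_eq)
    have "v \<bullet> e i = w \<bullet> e i" if "i \<in> {1..?m}" for i
      using fun_cong [OF \<open>\<sigma> v = \<sigma> w\<close>, of i] that nz [of w] unfolding \<sigma>_def d by simp
    then have "(\<Sum>i=1..?m. (v \<bullet> e i) *\<^sub>R e i) = (\<Sum>i=1..?m. (w \<bullet> e i) *\<^sub>R e i)"
      by (intro sum.cong) auto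
    then show ?thesis
      using e(5) that by simp
  qed
  have surj: "y \<in> \<sigma> ` V" if y: "y \<in> topspace (nsphere ?m)" "y \<noteq> sphere_point" for y
  proof -
    have sum1: "(y 0)\<^sup>2 + (\<Sum>i=1..?m. (y i)\<^sup>2) = 1" and zero: "\<And>i. i > ?m \<Longrightarrow> y i = 0"
        using y split [of "\<lambda>i. (y i)\<^sup>2"] by (auto simp: nsphere)
    have "y 0 \<noteq> 1"
    proof
      assume "y 0 = 1"
      then have "\<forall>i\<in>{1..?m}. y i = 0"
        using sum1 by (simp add: sum_nonneg_eq_0_iff)
      then have "y = sphere_point"
        using zero \<open>y 0 = 1\<close> unfolding sphere_point_def fun_eq_iff
        by (metis One_nat_def Suc_leI atLeastAtMost_iff gr0I linorder_not_le)
      then show False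
        using y by simp
    qed
    moreover have "(y 0)\<^sup>2 \<le> 1"
      using sum1 sum_nonneg [of "{1..?m}" "\<lambda>i. (y i)\<^sup>2"] by simp
    then have "y 0 \<le> 1"
      using abs_square_le_1 [of "y 0"] by linarith
    ultimately have y1: "1 - y 0 > 0"
      by simp
    define v where "v = (\<Sum>i=1..?m. (y i / (1 - y 0)) *\<^sub>R e i)"
    have vV: "v \<in> V"
      unfolding v_def using V e(1) by (intro subspace_sum subspace_scale) auto
    have coord: "v \<bullet> e j = y j / (1 - y 0)" if "j \<in> {1..?m}" for j
    proof -
      have "v \<bullet> e j = (\<Sum>i=1..?m. (y i / (1 - y 0)) * (e i \<bullet> e j))"
        by (simp add: v_def inner_sum_left)
      also have "\<dots> = (\<Sum>i=1..?m. if i = j then y j / (1 - y 0) else 0)"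
        using that e(3) by (intro sum.cong) auto
      finally show ?thesis
        using that by simp
    qed
    have "(norm v)\<^sup>2 = (\<Sum>i=1..?m. (y i)\<^sup>2 / (1 - y 0)\<^sup>2)"
      using e(6) [OF vV] coord by (simp add: power_divide)
    also have "\<dots> = (1 - (y 0)\<^sup>2) / (1 - y 0)\<^sup>2"
      using sum1 by (simp flip: sum_divide_distrib)
    also have "\<dots> = (1 + y 0) / (1 - y 0)"
      using y1 by (simp add: divide_simps) (simp add: power2_eq_square algebra_simps)
    finally have "(norm v)\<^sup>2 + 1 = (1 + y 0) / (1 - y 0) + 1"
      by simp
    also have "\<dots> = 2 / (1 - y 0)"
      using y1 by (simp add: divide_simps)
    finally have d: "(norm v)\<^sup>2 + 1 = 2 / (1 - y 0)" .
    have "\<sigma> v i = y i" for i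
    proof (cases "i \<in> {1..?m}")
      case True
      then show ?thesis
        unfolding \<sigma>_def d using coord y1 by simp
    next
      case False
      then consider "i = 0" | "i > ?m" "i \<noteq> 0"
        by fastforce
      then show ?thesis
      proof cases
        case 1
        then show ?thesis
          unfolding \<sigma>_def d using y1 by (simp add: diff_divide_distrib)
      next
        case 2
        then show ?thesis
          using zero e(4) [of i] by (simp add: \<sigma>_def)
      qed
    qed
    then have "\<sigma> v = y"
      by blast
    then show ?thesis
      using vV by blast
  qed
  have "bij_betw \<sigma> V (topspace (nsphere ?m) - {sphere_point})"
  proof (rule bij_betw_imageI)
    show "inj_on \<sigma> V"
      by (rule inj_onI) (rule inj)
    show "\<sigma> ` V = topspace (nsphere ?m) - {sphere_point}"
    proof
      show "\<sigma> ` V \<subseteq> topspace (nsphere ?m) - {sphere_point}"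
        using mem by (rule image_subsetI)
      show "topspace (nsphere ?m) - {sphere_point} \<subseteq> \<sigma> ` V"
        by (rule subsetI, rule surj) auto
    qed
  qed
  moreover have "\<bar>\<sigma> v i - sphere_point i\<bar> \<le> 2 / norm v" if "v \<noteq> 0" for v i
  proof (cases "i = 0")
    case True
    have "norm v \<le> (norm v)\<^sup>2 + 1"
      using sum_squares_bound [of "norm v" 1] pos [of v] by (simp add: power2_eq_square)
    then have "2 / ((norm v)\<^sup>2 + 1) \<le> 2 / norm v"
      using that by (intro divide_left_mono) (auto simp: mult_pos_pos pos)
    then show ?thesis
      using True pos [of v] by (simp add: \<sigma>_def sphere_point_def)
  next
    case False
    have "\<bar>v \<bullet> e i\<bar> \<le> norm v * norm (e i)"
      by (rule Cauchy_Schwarz_ineq2)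
    also have "\<dots> \<le> norm v"
      using e(2) [of i] by (simp add: mult_left_le)
    finally have "\<bar>v \<bullet> e i\<bar> * norm v \<le> norm v * norm v"
      by (simp add: mult_right_mono)
    then have "\<bar>v \<bullet> e i\<bar> * norm v \<le> (norm v)\<^sup>2 + 1"
      by (simp add: power2_eq_square)
    then have "\<bar>v \<bullet> e i\<bar> / ((norm v)\<^sup>2 + 1) \<le> 1 / norm v"
      using that pos [of v] by (simp add: divide_simps mult.commute)
    then show ?thesis
      using False pos [of v] by (simp add: \<sigma>_def sphere_point_def abs_mult)
  qed
  moreover have "continuous_on UNIV (\<lambda>v. \<sigma> v i)" for i
    using nz by (cases "i = 0") (auto simp: \<sigma>_def intro!: continuous_intros)
  ultimately show thesis
    by (intro that [of \<sigma>]) (simp_all add: \<sigma>_def)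
qed

section \<open>Projective spaces of modules\<close>

locale left_module =
  fixes s :: "'k::{real_normed_div_algebra, euclidean_space} \<Rightarrow> 'a::euclidean_space \<Rightarrow> 'a" and V :: "'a set"
  assumes is_left_module: "is_left_module s V"
begin

definition orbit :: "'a \<Rightarrow> 'a set" where
  "orbit v = {s c v | c. c \<noteq> 0}"

lemma subspace: "subspace V"
  using is_left_module unfolding is_left_module_def by blast

lemma scale_in: "v \<in> V \<Longrightarrow> s c v \<in> V"
  using is_left_module unfolding is_left_module_def by blast

lemma scale_add_right: "v \<in> V \<Longrightarrow> w \<in> V \<Longrightarrow> s c (v + w) = s c v + s c w"
  using is_left_module unfolding is_left_module_def by blast

lemma scale_add_left: "v \<in> V \<Longrightarrow> s (c + d) v = s c v + s d v"
  using is_left_module unfolding is_left_module_def by blast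

lemma scale_mult: "v \<in> V \<Longrightarrow> s (c * d) v = s c (s d v)"
  using is_left_module unfolding is_left_module_def by blast

lemma scale_of_real: "v \<in> V \<Longrightarrow> s (of_real t) v = t *\<^sub>R v"
  using is_left_module unfolding is_left_module_def by blast

lemma zero_in: "0 \<in> V"
  using subspace by (rule subspace_0)

lemma scaleR_in: "v \<in> V \<Longrightarrow> t *\<^sub>R v \<in> V"
  using subspace by (rule subspace_scale)

lemma scale_one: "v \<in> V \<Longrightarrow> s 1 v = v"
  using scale_of_real [of v 1] by simp

lemma scale_zero_right: "s c 0 = 0"
  using scale_add_right [OF zero_in zero_in, of c] by simp

lemma scale_inverse: "v \<in> V \<Longrightarrow> c \<noteq> 0 \<Longrightarrow> s (inverse c) (s c v) = v"
  by (simp add: scale_one flip: scale_mult)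

lemma scale_scaleR_left: "v \<in> V \<Longrightarrow> s (t *\<^sub>R c) v = t *\<^sub>R s c v"
  using scale_mult [of v "of_real t" c] scale_of_real [OF scale_in]
  by (simp add: scaleR_conv_of_real)

lemma scale_scaleR_right: "v \<in> V \<Longrightarrow> s c (t *\<^sub>R v) = t *\<^sub>R s c v"
  using scale_mult [of v c "of_real t"] scale_of_real [of v t] scale_scaleR_left [of v t c]
  by (simp add: of_real_def)

lemma orbit_self: "v \<in> V \<Longrightarrow> v \<in> orbit v"
  unfolding orbit_def by (rule CollectI, rule exI [of _ 1]) (simp add: scale_one)

lemma orbit_eqD:
  assumes "v \<in> V" "orbit v = orbit w"
  obtains c where "c \<noteq> 0" "v = s c w"
proof -
  have "v \<in> orbit w"
    using orbit_self [OF assms(1)] assms(2) by simp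
  then show thesis
    using that by (auto simp: orbit_def)
qed

lemma orbit_scale:
  assumes "v \<in> V" "c \<noteq> 0"
  shows "orbit (s c v) = orbit v"
proof
  show "orbit (s c v) \<subseteq> orbit v"
    using assms by (auto simp: orbit_def simp flip: scale_mult)
  show "orbit v \<subseteq> orbit (s c v)"
  proof
    fix w assume "w \<in> orbit v"
    then obtain d where d: "d \<noteq> 0" "w = s d v"
      by (auto simp: orbit_def)
    then have "w = s (d * inverse c) (s c v)" "d * inverse c \<noteq> 0"
      using assms by (simp_all add: scale_mult scale_inverse scale_in)
    then show "w \<in> orbit (s c v)"
      unfolding orbit_def by blast
  qed
qed

text \<open>
  The scalar multiplication is constrained only on \<open>V\<close>.  Composing it with a linear projection onto \<open>V\<close> makes it
  bilinear on the whole space, and in finite dimension this yields its continuity and a norm bound.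
\<close>

lemma bounded_bilinear_extension:
  obtains b where "bounded_bilinear b" "\<And>c v. v \<in> V \<Longrightarrow> b c v = s c v"
proof -
  obtain p :: "'a \<Rightarrow> 'a" where p: "linear p" "range p \<subseteq> V" "\<And>v. v \<in> V \<Longrightarrow> p v = v"
    using linear_exists_left_inverse_on [OF linear_id subspace] by auto
  have pV: "p v \<in> V" for v
    using p(2) by blast
  have "bilinear (\<lambda>c v. s c (p v))"
    unfolding bilinear_def
    by (auto intro!: linearI simp: linear_add [OF p(1)] linear_scale [OF p(1)] pV
        scale_add_left scale_add_right scale_scaleR_left scale_scaleR_right)
  then show thesis
    using that [of "\<lambda>c v. s c (p v)"] p(3) by (simp add: bilinear_conv_bounded_bilinear)
qed

abbreviation "P \<equiv> projective_space s V"

lemma quotient_map_orbit: "quotient_map (top_of_set (V - {0})) P orbit"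
  unfolding projective_space_def orbit_def by (rule quotient_map_quotient_topology)

lemma continuous_map_orbit: "continuous_map (top_of_set (V - {0})) P orbit"
  by (rule quotient_imp_continuous_map [OF quotient_map_orbit])

lemma topspace_P: "topspace P = orbit ` (V - {0})"
  using quotient_imp_surjective_map [OF quotient_map_orbit] by simp

text \<open>
  Every orbit meets the unit sphere of \<open>V\<close>, already by real scalars.
\<close>

lemma compact_space_P: "compact_space P"
proof -
  let ?S = "sphere 0 1 \<inter> V"
  have "compact ?S"
    by (intro compact_Int_closed closed_subspace subspace) auto
  then have "compactin (top_of_set (V - {0})) ?S"
    by (auto simp: compactin_subtopology)
  then have "compactin P (orbit ` ?S)"
    using continuous_map_orbit by (rule image_compactin)
  moreover have "orbit ` ?S = orbit ` (V - {0})"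
  proof
    show "orbit ` ?S \<subseteq> orbit ` (V - {0})"
      by (rule image_mono) auto
    show "orbit ` (V - {0}) \<subseteq> orbit ` ?S"
    proof (rule image_subsetI)
      fix v assume "v \<in> V - {0}"
      then have v: "v \<in> V" "v \<noteq> 0"
        by auto
      let ?w = "inverse (norm v) *\<^sub>R v"
      have "orbit ?w = orbit (s (of_real (inverse (norm v))) v)"
        using v by (simp only: scale_of_real)
      also have "\<dots> = orbit v"
        using v by (intro orbit_scale) auto
      finally have "orbit v = orbit ?w" ..
      moreover have "?w \<in> ?S"
        using v scaleR_in by simp
      ultimately show "orbit v \<in> orbit ` ?S"
        by (rule image_eqI)
    qed
  qed
  ultimately show ?thesis
    by (simp add: compact_space_def topspace_P)
qed

end

lemma is_left_module_prod:
  assumes "is_left_module s V" "is_left_module t L"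
  shows "is_left_module (\<lambda>c (v, q). (s c v, t c q)) (V \<times> L)"
  using assms subspace_Times unfolding is_left_module_def by auto

locale two_modules = M: left_module s V + N: left_module t L
  for s :: "'k::{real_normed_div_algebra, euclidean_space} \<Rightarrow> 'a::euclidean_space \<Rightarrow> 'a" and V
    and t :: "'k \<Rightarrow> 'b::euclidean_space \<Rightarrow> 'b" and L
begin

abbreviation "st \<equiv> \<lambda>c (v, q). (s c v, t c q)"

sublocale left_module st "V \<times> L"
  by unfold_locales (rule is_left_module_prod [OF M.is_left_module N.is_left_module])

definition incl :: "'a set \<Rightarrow> ('a \<times> 'b) set" where
  "incl = image (\<lambda>v. (v, 0))"

lemma projective_inclusion_eq: "projective_inclusion = map_sum incl id"
  by (simp add: projective_inclusion_def incl_def fun_eq_iff)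

lemma incl_orbit: "incl (M.orbit v) = orbit (v, 0)"
  by (auto simp: incl_def orbit_def M.orbit_def N.scale_zero_right image_iff)

lemma fst_orbit: "fst ` orbit p = M.orbit (fst p)"
  by (cases p) (force simp: orbit_def M.orbit_def)

lemma topspace_P_pair: "topspace P = orbit ` (V \<times> L - {(0, 0)})"
  using topspace_P by (simp add: zero_prod_def)

lemma orbit_in_incl_iff:
  assumes "v \<in> V" "q \<in> L" "(v, q) \<noteq> 0"
  shows "orbit (v, q) \<in> incl ` topspace M.P \<longleftrightarrow> q = 0"
proof
  assume "orbit (v, q) \<in> incl ` topspace M.P"
  then obtain O' where "O' \<in> topspace M.P" "orbit (v, q) = incl O'"
    by (rule imageE)
  moreover from this(1) obtain w where "O' = M.orbit w"
    unfolding M.topspace_P by (rule imageE)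
  ultimately have eq: "orbit (v, q) = orbit (w, 0)"
    by (simp add: incl_orbit)
  have "(v, q) \<in> V \<times> L"
    using assms by simp
  then obtain c where "(v, q) = st c (w, 0)"
    using eq by (rule orbit_eqD)
  then show "q = 0"
    by (simp add: N.scale_zero_right)
next
  assume "q = 0"
  then show "orbit (v, q) \<in> incl ` topspace M.P"
    using assms incl_orbit [of v] by (force simp: M.topspace_P zero_prod_def)
qed

text \<open>
  Points of the projective spaces are orbits, so the projection \<open>V \<times> L \<rightarrow> V\<close> acts on them as \<open>image fst\<close>.
  Restricted to the closed set of points \<open>[v, 0]\<close>, this is a continuous inverse of the inclusion.
\<close>

lemma embedding_map_incl: "embedding_map M.P P incl"
proof -
  let ?T = "V \<times> L - {0}"
  let ?Z = "incl ` topspace M.P"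
  have ZP: "?Z \<subseteq> topspace P"
    by (force simp: M.topspace_P topspace_P_pair incl_orbit N.zero_in)
  have pre: "{p \<in> topspace (top_of_set ?T). orbit p \<in> ?Z} = {p \<in> ?T. snd p = 0}"
    using orbit_in_incl_iff by force
  have "continuous_map M.P P incl"
  proof (rule continuous_compose_quotient_map [OF M.quotient_map_orbit])
    have "continuous_map (top_of_set (V - {0})) (top_of_set ?T) (\<lambda>v. (v, 0))"
      by (auto intro!: continuous_intros simp: N.zero_in zero_prod_def)
    then have "continuous_map (top_of_set (V - {0})) P (orbit \<circ> (\<lambda>v. (v, 0)))"
      using continuous_map_orbit by (rule continuous_map_compose)
    then show "continuous_map (top_of_set (V - {0})) P (incl \<circ> M.orbit)"
      by (simp add: o_def incl_orbit)
  qed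
  moreover have "continuous_map (subtopology P ?Z) M.P (image fst)"
  proof (rule continuous_compose_quotient_map)
    have "closedin (top_of_set ?T) {p \<in> ?T. snd p = 0}"
      by (rule continuous_closedin_preimage_constant) (intro continuous_intros)
    then have "closedin (top_of_set ?T) {p \<in> topspace (top_of_set ?T). orbit p \<in> ?Z}"
      by (simp only: pre)
    moreover have "closedin (top_of_set ?T) {p \<in> topspace (top_of_set ?T). orbit p \<in> U} \<longleftrightarrow> closedin P U"
      if "U \<subseteq> topspace P" for U
      using quotient_map_orbit that unfolding quotient_map_closedin by simp
    ultimately have "closedin P ?Z"
      using ZP by simp
    then show "quotient_map (subtopology (top_of_set ?T) {p \<in> ?T. snd p = 0}) (subtopology P ?Z) orbit"
      using quotient_map_orbit pre by (intro quotient_map_restriction) auto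
    have "continuous_map (top_of_set (?T \<inter> {p \<in> ?T. snd p = 0})) (top_of_set (V - {0})) fst"
      by (auto intro!: continuous_intros simp: zero_prod_def)
    then have "continuous_map (top_of_set (?T \<inter> {p \<in> ?T. snd p = 0})) M.P (M.orbit \<circ> fst)"
      using M.continuous_map_orbit by (rule continuous_map_compose)
    then show "continuous_map (subtopology (top_of_set ?T) {p \<in> ?T. snd p = 0}) M.P (image fst \<circ> orbit)"
      unfolding subtopology_subtopology
      by (rule continuous_map_eq) (simp add: fst_orbit)
  qed
  ultimately have "homeomorphic_maps M.P (subtopology P ?Z) incl (image fst)"
    by (auto simp add: homeomorphic_maps_def continuous_map_in_subtopology M.topspace_P incl_orbit fst_orbit simp del: image_cong_simp)
  then show ?thesis
    unfolding embedding_map_def by (rule homeomorphic_maps_imp_map)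
qed

lemma embedding_map_projective_inclusion:
  "embedding_map (fst (add_basepoint M.P)) (fst (add_basepoint P)) projective_inclusion"
  unfolding projective_inclusion_eq by (rule embedding_map_add_basepoint [OF embedding_map_incl])

text \<open>
  Here the inclusion is onto, so the constant function 0 and the constant homotopy form a neighbourhood deformation.
\<close>

lemma cofiber_sequence_trivial_extension:
  assumes L: "L = {0}"
  shows "cofiber_sequence (add_basepoint M.P) projective_inclusion (add_basepoint P)
           (\<lambda>_. sphere_point) pointed_pt"
proof -
  have onto: "projective_inclusion ` topspace (fst (add_basepoint M.P)) = topspace (fst (add_basepoint P))"
  proof -
    have "incl ` topspace M.P = topspace P"
    proof -
      have "V \<times> L - {(0, 0)} = (\<lambda>v. (v, 0)) ` (V - {0})"
        by (auto simp: L)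
      then show ?thesis
        unfolding topspace_P_pair M.topspace_P by (simp add: image_image incl_orbit)
    qed
    then have "topspace P = incl ` topspace M.P" ..
    then show ?thesis
      by (simp add: topspace_add_basepoint projective_inclusion_eq image_image)
  qed
  interpret neighbourhood_deformation "add_basepoint M.P" projective_inclusion "add_basepoint P"
    "\<lambda>_. 0" snd
    using onto embedding_map_projective_inclusion
    by unfold_locales
      (auto simp: topspace_add_basepoint add_basepoint_def projective_inclusion_def intro: continuous_map_snd)
  show ?thesis
  proof (rule cofiber_sequence_collapse)
    show "quotient_map (fst (add_basepoint P)) (fst pointed_pt) (\<lambda>_. sphere_point)"
      by (intro continuous_imp_quotient_map compact_space_add_basepoint compact_space_P)
        (auto simp: pointed_pt_def topspace_add_basepoint)
  qed (auto simp: pointed_pt_def)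
qed

end

section \<open>Adding a line\<close>

text \<open>
  The coordinate \<open>\<phi>\<close> identifies \<open>L\<close> with the one-dimensional module \<open>K\<close>.
\<close>

locale line_extension = two_modules s V t L
  for s :: "'k::{real_normed_div_algebra, euclidean_space} \<Rightarrow> 'a::euclidean_space \<Rightarrow> 'a" and V
    and t :: "'k \<Rightarrow> 'b::euclidean_space \<Rightarrow> 'b" and L +
  fixes \<phi> :: "'b \<Rightarrow> 'k"
  assumes \<phi>_bounded_linear: "bounded_linear \<phi>"
    and \<phi>_bij: "bij_betw \<phi> L UNIV"
    and \<phi>_scale: "\<And>c q. q \<in> L \<Longrightarrow> \<phi> (t c q) = c * \<phi> q"
begin

abbreviation "T \<equiv> V \<times> L - {0}"

lemma \<phi>_eq_0_iff: "q \<in> L \<Longrightarrow> \<phi> q = 0 \<longleftrightarrow> q = 0"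
  using \<phi>_bij N.zero_in linear_0 [OF bounded_linear.linear [OF \<phi>_bounded_linear]]
  by (metis bij_betw_imp_inj_on inj_onD)

text \<open>
  The affine coordinate of \<open>[v, q]\<close> is the vector \<open>w\<close> with \<open>[v, q] = [w, e]\<close>, where \<open>e\<close> is the element of \<open>L\<close> with coordinate 1.
\<close>

definition affine :: "'a \<times> 'b \<Rightarrow> 'a" where
  "affine p = s (inverse (\<phi> (snd p))) (fst p)"

lemma affine_in: "p \<in> T \<Longrightarrow> affine p \<in> V"
  by (auto simp: affine_def M.scale_in)

lemma affine_scale:
  assumes "p \<in> T" "c \<noteq> 0" "snd p \<noteq> 0"
  shows "affine (st c p) = affine p"
proof -
  obtain v q where p: "p = (v, q)" "v \<in> V" "q \<in> L"
    using assms by auto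
  then have "\<phi> q \<noteq> 0"
    using assms \<phi>_eq_0_iff by simp
  then have "inverse (c * \<phi> q) = inverse (\<phi> q) * inverse c"
    using assms by (simp add: nonzero_inverse_mult_distrib)
  then show ?thesis
    using assms p by (simp add: affine_def \<phi>_scale M.scale_mult M.scale_in M.scale_inverse)
qed

text \<open>
  Equal affine coordinates put both points in the orbit of the same \<open>(w, e)\<close>; explicitly, \<open>p\<close> is \<open>p'\<close>
  scaled by the quotient of their coordinates in \<open>L\<close>.
\<close>

lemma orbit_eq_if_affine_eq:
  assumes p: "p \<in> T" "snd p \<noteq> 0" and p': "p' \<in> T" "snd p' \<noteq> 0" and eq: "affine p = affine p'"
  shows "orbit p = orbit p'"
proof -
  obtain v q where v: "p = (v, q)" "v \<in> V" "q \<in> L"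
    using p by auto
  obtain w l where w: "p' = (w, l)" "w \<in> V" "l \<in> L"
    using p' by auto
  have nz: "\<phi> q \<noteq> 0" "\<phi> l \<noteq> 0"
    using v w p p' \<phi>_eq_0_iff by auto
  let ?c = "\<phi> q * inverse (\<phi> l)"
  have "s ?c w = s (\<phi> q) (affine p')"
    using w by (simp add: affine_def M.scale_mult)
  also have "\<dots> = s (\<phi> q) (s (inverse (\<phi> q)) v)"
    using v eq by (simp add: affine_def)
  also have "\<dots> = v"
    using M.scale_inverse [of v "inverse (\<phi> q)"] v nz by simp
  finally have "s ?c w = v" .
  moreover have "\<phi> (t ?c l) = \<phi> q"
    using w nz by (simp add: \<phi>_scale mult.assoc)
  then have "t ?c l = q"
    using \<phi>_bij w v N.scale_in by (metis bij_betw_imp_inj_on inj_onD)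
  ultimately have "st ?c p' = p"
    using v w by simp
  moreover have "?c \<noteq> 0"
    using nz by simp
  ultimately show ?thesis
    using orbit_scale [of p' ?c] p' by auto
qed

text \<open>
  The affine coordinate tends to infinity near \<open>P(V)\<close>.  The scalar multiplication need not be isometric, but it
  is bounded: if \<open>v = \<lambda> w\<close> then \<open>\<bar>v\<bar> \<le> K \<bar>\<lambda>\<bar> \<bar>w\<bar>\<close>.
\<close>

lemma affine_norm_bound:
  obtains K where "K > 0" "\<And>p. \<lbrakk>p \<in> T; snd p \<noteq> 0; fst p \<noteq> 0\<rbrakk> \<Longrightarrow>
      affine p \<noteq> 0 \<and> 1 / norm (affine p) \<le> K * norm (\<phi> (snd p)) / norm (fst p)"
proof -
  obtain b where b: "bounded_bilinear b" "\<And>c v. v \<in> V \<Longrightarrow> b c v = s c v"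
    by (rule M.bounded_bilinear_extension, rule that)
  obtain K where K: "K > 0" "\<And>c v. norm (b c v) \<le> norm c * norm v * K"
    using bounded_bilinear.pos_bounded [OF b(1)] by auto
  have "affine p \<noteq> 0 \<and> 1 / norm (affine p) \<le> K * norm (\<phi> (snd p)) / norm (fst p)"
    if p: "p \<in> T" "snd p \<noteq> 0" "fst p \<noteq> 0" for p
  proof -
    have V: "fst p \<in> V" "snd p \<in> L"
      using p by auto
    then have nz: "\<phi> (snd p) \<noteq> 0"
      using p \<phi>_eq_0_iff by simp
    have recover: "s (\<phi> (snd p)) (affine p) = fst p"
      using M.scale_inverse [of "fst p" "inverse (\<phi> (snd p))"] V nz by (simp add: affine_def)
    then have a0: "affine p \<noteq> 0"
      using p M.scale_zero_right [of "\<phi> (snd p)"] by auto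
    have "norm (fst p) \<le> norm (\<phi> (snd p)) * norm (affine p) * K"
      using K(2) [of "\<phi> (snd p)" "affine p"] b(2) [OF affine_in [OF p(1)]] recover by simp
    then have "1 / norm (affine p) \<le> K * norm (\<phi> (snd p)) / norm (fst p)"
      using a0 p by (simp add: divide_simps mult_ac)
    then show ?thesis
      using a0 by simp
  qed
  then show thesis
    using that K(1) by blast
qed

context
  fixes \<sigma> :: "'a \<Rightarrow> nat \<Rightarrow> real"
  assumes \<sigma>_cont: "\<And>i. continuous_on UNIV (\<lambda>v. \<sigma> v i)"
    and \<sigma>_bij: "bij_betw \<sigma> V (topspace (nsphere (dim V)) - {sphere_point})"
    and \<sigma>_bound: "\<And>v i. v \<noteq> 0 \<Longrightarrow> \<bar>\<sigma> v i - sphere_point i\<bar> \<le> 2 / norm v"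
    and \<sigma>_height: "\<And>v. \<sigma> v 0 = 1 - 2 / ((norm v)\<^sup>2 + 1)"
begin

definition sphere_map :: "'a \<times> 'b \<Rightarrow> nat \<Rightarrow> real" where
  "sphere_map p = (if \<phi> (snd p) = 0 then sphere_point else \<sigma> (affine p))"

text \<open>
  Away from \<open>q = 0\<close> the map is a composition of continuous maps.  At a point with \<open>q = 0\<close>, its distance to
  \<open>sphere_point\<close> is controlled by the bounds on \<open>\<sigma>\<close> and on the affine coordinate.
\<close>

lemma continuous_on_sphere_map: "continuous_on T (\<lambda>p. sphere_map p i)"
  unfolding continuous_on_def
proof
  fix p assume p: "p \<in> T"
  have \<phi>_cont: "continuous_on UNIV (\<lambda>p :: 'a \<times> 'b. \<phi> (snd p))"
    by (rule continuous_on_compose2 [OF linear_continuous_on [OF \<phi>_bounded_linear, of UNIV]])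
      (auto intro: continuous_intros)
  show "((\<lambda>p. sphere_map p i) \<longlongrightarrow> sphere_map p i) (at p within T)"
  proof (cases "snd p = 0")
    case False
    then have nz: "\<phi> (snd p) \<noteq> 0"
      using p \<phi>_eq_0_iff by auto
    obtain b where b: "bounded_bilinear b" "\<And>c v. v \<in> V \<Longrightarrow> b c v = s c v"
      by (rule M.bounded_bilinear_extension, rule that)
    let ?U = "{p \<in> T. \<phi> (snd p) \<noteq> 0}"
    have "continuous_on ?U (\<lambda>p. b (inverse (\<phi> (snd p))) (fst p))"
      by (intro bounded_bilinear.continuous_on [OF b(1)] continuous_on_inverse
          continuous_on_subset [OF \<phi>_cont] continuous_intros) auto
    then have "continuous_on ?U affine"
      by (rule continuous_on_eq) (auto simp: affine_def b)
    then have "continuous_on ?U (\<lambda>p. \<sigma> (affine p) i)"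
      by (rule continuous_on_compose2 [OF \<sigma>_cont]) auto
    then have "continuous_on ?U (\<lambda>p. sphere_map p i)"
      by (rule continuous_on_eq) (auto simp: sphere_map_def)
    then have "((\<lambda>p. sphere_map p i) \<longlongrightarrow> sphere_map p i) (at p within ?U)"
      using p nz by (auto simp: continuous_on_def)
    moreover have "at p within ?U = at p within T"
    proof (rule at_within_nhd)
      show "open {p :: 'a \<times> 'b. \<phi> (snd p) \<noteq> 0}"
        by (rule open_Collect_neq [OF \<phi>_cont]) (rule continuous_on_const)
    qed (use nz in auto)
    ultimately show ?thesis
      by simp
  next
    case True
    then have p0: "\<phi> (snd p) = 0" "fst p \<noteq> 0"
      using p \<phi>_eq_0_iff [of "snd p"] by (auto simp: prod_eq_iff)
    obtain K where K: "K > 0" "\<And>p. \<lbrakk>p \<in> T; snd p \<noteq> 0; fst p \<noteq> 0\<rbrakk> \<Longrightarrow>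
        affine p \<noteq> 0 \<and> 1 / norm (affine p) \<le> K * norm (\<phi> (snd p)) / norm (fst p)"
      by (rule affine_norm_bound, rule that)
    have bound: "norm (sphere_map p' i - sphere_map p i) \<le> 2 * (K * norm (\<phi> (snd p')) / norm (fst p'))"
      if "p' \<in> T" "fst p' \<noteq> 0" for p'
    proof (cases "\<phi> (snd p') = 0")
      case True
      then show ?thesis
        using p0 by (simp add: sphere_map_def)
    next
      case False
      then have "snd p' \<noteq> 0"
        using that \<phi>_eq_0_iff by auto
      then have *: "affine p' \<noteq> 0" "1 / norm (affine p') \<le> K * norm (\<phi> (snd p')) / norm (fst p')"
        using K(2) that by auto
      have "norm (sphere_map p' i - sphere_map p i) \<le> 2 / norm (affine p')"
        using False p0 \<sigma>_bound [OF *(1)] by (simp add: sphere_map_def)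
      also have "\<dots> \<le> 2 * (K * norm (\<phi> (snd p')) / norm (fst p'))"
        using *(2) by simp
      finally show ?thesis .
    qed
    have "isCont (\<lambda>p. \<phi> (snd p)) p"
      using \<phi>_cont continuous_on_eq_continuous_at [OF open_UNIV] by blast
    then have "isCont (\<lambda>p'. 2 * (K * norm (\<phi> (snd p')) / norm (fst p'))) p"
      using p0 by (intro continuous_intros) auto
    then have "((\<lambda>p'. 2 * (K * norm (\<phi> (snd p')) / norm (fst p'))) \<longlongrightarrow> 0) (at p within T)"
      using p0 unfolding continuous_at by (auto intro: tendsto_within_subset)
    moreover have "\<forall>\<^sub>F p' in at p within T. norm (sphere_map p' i - sphere_map p i) \<le> 2 * (K * norm (\<phi> (snd p')) / norm (fst p'))"
    proof -
      have "open {p :: 'a \<times> 'b. fst p \<noteq> 0}"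
        by (intro open_Collect_neq continuous_intros)
      then have "\<forall>\<^sub>F p' in at p within T. fst p' \<noteq> 0"
        using p0 by (metis (mono_tags, lifting) eventually_at_topological mem_Collect_eq)
      moreover have "\<forall>\<^sub>F p' in at p within T. p' \<in> T"
        by (simp add: eventually_at_filter)
      ultimately show ?thesis
        by eventually_elim (rule bound)
    qed
    ultimately have "((\<lambda>p'. sphere_map p' i - sphere_map p i) \<longlongrightarrow> 0) (at p within T)"
      by (rule Lim_null_comparison [rotated])
    then show ?thesis
      by (simp add: LIM_zero_iff)
  qed
qed

lemma sphere_map_scale:
  assumes p: "p \<in> T" "c \<noteq> 0"
  shows "sphere_map (st c p) = sphere_map p"
proof -
  have "snd p \<in> L"
    using p by auto
  then have "\<phi> (snd (st c p)) = c * \<phi> (snd p)" "\<phi> (snd p) = 0 \<longleftrightarrow> snd p = 0"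
    using \<phi>_scale \<phi>_eq_0_iff by (simp_all add: case_prod_unfold)
  then show ?thesis
    using affine_scale [OF p] p by (simp add: sphere_map_def)
qed

lemma sphere_map_in:
  assumes "p \<in> T"
  shows "sphere_map p \<in> topspace (nsphere (dim V))"
proof (cases "\<phi> (snd p) = 0")
  case True
  then show ?thesis
    using in_topspace_nsphere by (simp add: sphere_map_def sphere_point_def)
next
  case False
  then show ?thesis
    using bij_betwE [OF \<sigma>_bij] affine_in [OF assms] by (auto simp: sphere_map_def)
qed

lemma continuous_map_sphere_map: "continuous_map (top_of_set T) (nsphere (dim V)) sphere_map"
proof -
  have "continuous_map (top_of_set T) (powertop_real UNIV) sphere_map"
    using continuous_on_sphere_map by (simp add: continuous_map_componentwise_UNIV)
  then show ?thesis
    using sphere_map_in by (auto simp: nsphere continuous_map_in_subtopology)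
qed

lemma sigma_ne_sphere_point: "v \<in> V \<Longrightarrow> \<sigma> v \<noteq> sphere_point"
  using bij_betwE [OF \<sigma>_bij] by auto

lemma sphere_map_eq_sphere_point_iff:
  assumes "p \<in> T"
  shows "sphere_map p = sphere_point \<longleftrightarrow> snd p = 0"
  using assms \<phi>_eq_0_iff sigma_ne_sphere_point affine_in [OF assms] by (auto simp: sphere_map_def)

lemma height_eq_0_iff:
  assumes "p \<in> T"
  shows "1 - sphere_map p 0 = 0 \<longleftrightarrow> snd p = 0"
proof -
  have "1 - \<sigma> v 0 \<noteq> 0" for v
    using sum_power2_ge_zero [of "norm v" 0] by (simp add: \<sigma>_height add_nonneg_eq_0_iff)
  moreover have "snd p \<in> L"
    using assms by auto
  ultimately show ?thesis
    using \<phi>_eq_0_iff by (simp add: sphere_map_def sphere_point_def)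
qed

lemma height_nonneg: "0 \<le> 1 - sphere_map p 0"
  by (simp add: sphere_map_def sphere_point_def \<sigma>_height)

lemma height_fst_0:
  assumes "p \<in> T" "fst p = 0"
  shows "1 - sphere_map p 0 = 2"
proof -
  have "snd p \<noteq> 0" "snd p \<in> L"
    using assms by (auto simp: prod_eq_iff)
  then show ?thesis
    using assms \<phi>_eq_0_iff by (simp add: sphere_map_def \<sigma>_height affine_def M.scale_zero_right)
qed

text \<open>
  At time \<open>r\<close> the second component is scaled by \<open>1 - r + r max 0 (u - 1)\<close>, where \<open>u = 1 - sphere_map p 0\<close> lies
  between 0 and 2.  At time 1 this is zero if \<open>u \<le> 1\<close>, whereas it is constantly 1 if \<open>u = 2\<close>, that is, at
  \<open>v = 0\<close>, so the result is never the zero vector.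
\<close>

definition contract :: "real \<times> 'a \<times> 'b \<Rightarrow> 'a \<times> 'b" where
  "contract = (\<lambda>(r, p). (fst p, (1 - r + r * max 0 (1 - sphere_map p 0 - 1)) *\<^sub>R snd p))"

lemma contract_in:
  assumes "p \<in> T"
  shows "contract (r, p) \<in> T"
proof (cases "fst p = 0")
  case True
  then have "contract (r, p) = p"
    using height_fst_0 [OF assms True] by (simp add: contract_def prod_eq_iff)
  then show ?thesis
    using assms by simp
next
  case False
  then show ?thesis
    using assms N.scaleR_in by (auto simp: contract_def prod_eq_iff)
qed

lemma contract_scale:
  assumes "p \<in> T" "c \<noteq> 0"
  shows "contract (r, st c p) = st c (contract (r, p))"
proof -
  have "snd p \<in> L"
    using assms by auto
  then show ?thesis
    unfolding contract_def prod.case sphere_map_scale [OF assms]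
    by (simp add: case_prod_unfold N.scale_scaleR_right)
qed

lemma continuous_on_contract: "continuous_on ({0..1} \<times> T) contract"
proof -
  have "continuous_on ({0..1 :: real} \<times> T) (\<lambda>z. sphere_map (snd z) 0)"
    by (rule continuous_on_compose2 [OF continuous_on_sphere_map]) (auto intro: continuous_intros)
  then show ?thesis
    unfolding contract_def case_prod_unfold by (intro continuous_intros)
qed

text \<open>
  The maps \<open>sphere_map\<close> and \<open>contract\<close> are compatible with scalars, so they descend to \<open>g\<close> and \<open>D\<close> on
  the projective space.  They are extended over the added basepoint, which goes to \<open>sphere_point\<close>.  The
  extension of \<open>g\<close> is a quotient map since it is onto from a compact to a Hausdorff space; the added
  basepoint is needed for surjectivity if \<open>V = 0\<close>, where \<open>P(V)\<close> is empty.
\<close>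

lemma cofiber_sequence_sphere: "\<exists>g. cofiber_sequence (add_basepoint M.P) projective_inclusion (add_basepoint P) g
    (pointed_sphere (dim V))"
proof -
  let ?S = "nsphere (dim V)"
  let ?I = "top_of_set {0..1 :: real}"
  have orbit_cases: "\<exists>c. c \<noteq> 0 \<and> p = st c p'" if "p \<in> T" "orbit p = orbit p'" for p p'
    using orbit_eqD [OF _ that(2)] that(1) by blast
  obtain g where g: "continuous_map P ?S g" "\<And>p. p \<in> T \<Longrightarrow> g (orbit p) = sphere_map p"
  proof (rule quotient_map_lift_exists [OF quotient_map_orbit continuous_map_sphere_map])
    show "sphere_map p = sphere_map p'" if "p \<in> topspace (top_of_set T)" "p' \<in> topspace (top_of_set T)" "orbit p = orbit p'" for p p'
      using orbit_cases [of p p'] that sphere_map_scale by auto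
  qed auto
  obtain D where D: "continuous_map (prod_topology ?I P) P D"
    "\<And>r p. \<lbrakk>r \<in> {0..1}; p \<in> T\<rbrakk> \<Longrightarrow> D (r, orbit p) = orbit (contract (r, p))"
  proof (rule quotient_map_lift_exists [OF quotient_map_interval_prod [OF quotient_map_orbit]])
    have "continuous_map (prod_topology ?I (top_of_set T)) (top_of_set T) contract"
      using continuous_on_contract contract_in by auto
    then show "continuous_map (prod_topology ?I (top_of_set T)) P (orbit \<circ> contract)"
      using continuous_map_orbit by (rule continuous_map_compose)
    show "(orbit \<circ> contract) z = (orbit \<circ> contract) z'"
      if z: "z \<in> topspace (prod_topology ?I (top_of_set T))" "z' \<in> topspace (prod_topology ?I (top_of_set T))"
        and eq: "(case z of (r, p) \<Rightarrow> (r, orbit p)) = (case z' of (r, p) \<Rightarrow> (r, orbit p))" for z z'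
    proof -
      obtain r p where r: "z = (r, p)"
        by (cases z)
      obtain r' p' where r': "z' = (r', p')"
        by (cases z')
      have rp: "z = (r, p)" "z' = (r, p')" "p \<in> T" "p' \<in> T" "orbit p = orbit p'"
        using z eq unfolding r r' by simp_all
      then obtain c where "c \<noteq> 0" "p = st c p'"
        using orbit_cases by blast
      moreover have "contract (r, p') \<in> V \<times> L"
        using contract_in rp by blast
      ultimately show ?thesis
        using rp contract_scale [of p' c r] orbit_scale by simp
    qed
  qed auto
  define g' where "g' = case_sum g (\<lambda>_ :: unit. sphere_point)"
  define u where "u x = 1 - g' x 0" for x
  define D' where "D' = (\<lambda>(r :: real, x). map_sum (\<lambda>y. D (r, y)) (id :: unit \<Rightarrow> unit) x)"
  have cases: "(\<exists>p. p \<in> T \<and> x = Inl (orbit p)) \<or> x = Inr ()"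
    if "x \<in> topspace (fst (add_basepoint P))" for x
    using that unfolding topspace_add_basepoint topspace_P by blast
  have g'_orbit: "g' (Inl (orbit p)) = sphere_map p" if "p \<in> T" for p
    using g(2) [OF that] by (simp add: g'_def)
  have u_orbit: "u (Inl (orbit p)) = 1 - sphere_map p 0" if "p \<in> T" for p
    using g'_orbit [OF that] by (simp add: u_def)
  have u_base: "u (Inr ()) = 0"
    by (simp add: u_def g'_def sphere_point_def)
  have D'_orbit: "D' (r, Inl (orbit p)) = Inl (orbit (contract (r, p)))" if "r \<in> {0..1}" "p \<in> T" for r p
    using D(2) [OF that] by (simp add: D'_def)
  let ?i = "projective_inclusion :: 'a set + unit \<Rightarrow> ('a \<times> 'b) set + unit"
  have image_iff: "Inl (orbit p) \<in> ?i ` topspace (fst (add_basepoint M.P)) \<longleftrightarrow> snd p = 0"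
    if "p \<in> T" for p
    using orbit_in_incl_iff [of "fst p" "snd p"] that
    by (auto simp: topspace_add_basepoint projective_inclusion_eq image_image image_iff)
  have image_cases: "(\<exists>p\<in>T. snd p = 0 \<and> ?i a = Inl (orbit p)) \<or> ?i a = Inr ()"
    if a: "a \<in> topspace (fst (add_basepoint M.P))" for a
  proof -
    consider v where "v \<in> V - {0}" "a = Inl (M.orbit v)" | "a = Inr ()"
      using a unfolding topspace_add_basepoint M.topspace_P by blast
    then show ?thesis
    proof cases
      case (1 v)
      then have "(v, 0) \<in> T" "?i a = Inl (orbit (v, 0))"
        by (simp_all add: N.zero_in zero_prod_def projective_inclusion_eq incl_orbit)
      then show ?thesis
        by force
    next
      case 2
      then show ?thesis
        by (simp add: projective_inclusion_eq)
    qed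
  qed
  have base: "Inr () \<in> ?i ` topspace (fst (add_basepoint M.P))"
    by (auto simp: topspace_add_basepoint projective_inclusion_eq image_iff)
  have sphere_point_in: "sphere_point \<in> topspace ?S"
    using in_topspace_nsphere by (simp add: sphere_point_def)
  have g'_cont: "continuous_map (fst (add_basepoint P)) ?S g'"
    unfolding add_basepoint_def fst_conv
  proof (rule continuous_map_from_disjoint_union)
    show "continuous_map P ?S (g' \<circ> Inl)"
      using g(1) by (simp add: g'_def o_def)
    show "continuous_map (discrete_topology {()}) ?S (g' \<circ> Inr)"
      using sphere_point_in by (simp add: g'_def o_def)
  qed
  interpret neighbourhood_deformation "add_basepoint M.P" projective_inclusion "add_basepoint P" u D'
  proof
    show "continuous_map (fst (add_basepoint P)) euclideanreal u"
      unfolding u_def using continuous_map_compose [OF g'_cont continuous_map_nsphere_projection]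
      by (intro continuous_intros) (simp add: o_def)
    show "0 \<le> u x" if "x \<in> topspace (fst (add_basepoint P))" for x
      using cases [OF that]
    proof
      assume "\<exists>p. p \<in> T \<and> x = Inl (orbit p)"
      then obtain p where "p \<in> T" "x = Inl (orbit p)"
        by blast
      then show ?thesis
        by (simp only: u_orbit height_nonneg)
    qed (simp only: u_base order_refl)
    show "u x = 0 \<longleftrightarrow> x \<in> ?i ` topspace (fst (add_basepoint M.P))"
      if "x \<in> topspace (fst (add_basepoint P))" for x
      using cases [OF that]
    proof
      assume "\<exists>p. p \<in> T \<and> x = Inl (orbit p)"
      then obtain p where "p \<in> T" "x = Inl (orbit p)"
        by blast
      then show ?thesis
        by (simp only: u_orbit height_eq_0_iff image_iff)
    next
      assume "x = Inr ()"
      then show ?thesis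
        using base u_base by simp
    qed
    show "continuous_map (prod_topology ?I (fst (add_basepoint P))) (fst (add_basepoint P)) D'"
      unfolding add_basepoint_def fst_conv
    proof (rule continuous_map_from_prod_disjoint_union)
      let ?Y = "disjoint_union P (discrete_topology {()})"
      show "continuous_map (prod_topology ?I P) ?Y (\<lambda>(r, x). D' (r, Inl x))"
        using continuous_map_compose [OF D(1) continuous_map_Inl] by (simp add: D'_def o_def case_prod_unfold)
      show "continuous_map (prod_topology ?I (discrete_topology {()})) ?Y (\<lambda>(r, x). D' (r, Inr x))"
        by (simp add: D'_def case_prod_unfold InrI)
    qed
    show "D' (0, x) = x" if "x \<in> topspace (fst (add_basepoint P))" for x
      using cases [OF that]
    proof
      assume "\<exists>p. p \<in> T \<and> x = Inl (orbit p)"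
      then obtain p where "p \<in> T" "x = Inl (orbit p)"
        by blast
      then show ?thesis
        using D'_orbit [of 0 p] by (simp add: contract_def)
    next
      assume "x = Inr ()"
      then show ?thesis
        by (simp add: D'_def)
    qed
    show "D' (r, ?i a) = ?i a"
      if "r \<in> {0..1}" "a \<in> topspace (fst (add_basepoint M.P))" for r a
      using image_cases [OF that(2)]
    proof
      assume "\<exists>p\<in>T. snd p = 0 \<and> ?i a = Inl (orbit p)"
      then obtain p where p: "p \<in> T" "snd p = 0" "?i a = Inl (orbit p)"
        by blast
      then have "contract (r, p) = p"
        by (simp add: contract_def prod_eq_iff)
      then show ?thesis
        using p D'_orbit [OF that(1) p(1)] by simp
    next
      assume "?i a = Inr ()"
      then show ?thesis
        by (simp add: D'_def)
    qed
    show "D' (1, x) \<in> ?i ` topspace (fst (add_basepoint M.P))"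
      if "x \<in> topspace (fst (add_basepoint P))" "u x \<le> 1" for x
      using cases [OF that(1)]
    proof
      assume "\<exists>p. p \<in> T \<and> x = Inl (orbit p)"
      then obtain p where p: "p \<in> T" "x = Inl (orbit p)"
        by blast
      then have "snd (contract (1, p)) = 0"
        using that(2) u_orbit by (simp add: contract_def)
      then show ?thesis
        using image_iff [OF contract_in [OF p(1)], of 1] D'_orbit [of 1 p] p by simp
    next
      assume "x = Inr ()"
      then show ?thesis
        using base by (simp add: D'_def)
    qed
  qed (rule embedding_map_projective_inclusion,
      simp_all add: add_basepoint_def projective_inclusion_eq InrI)
  have "cofiber_sequence (add_basepoint M.P) projective_inclusion (add_basepoint P) g' (pointed_sphere (dim V))"
  proof (rule cofiber_sequence_collapse)
    have "g' ` topspace (fst (add_basepoint P)) = topspace ?S"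
    proof
      show "g' ` topspace (fst (add_basepoint P)) \<subseteq> topspace ?S"
        by (rule continuous_map_image_subset_topspace [OF g'_cont])
      show "topspace ?S \<subseteq> g' ` topspace (fst (add_basepoint P))"
      proof
        fix y assume y: "y \<in> topspace ?S"
        show "y \<in> g' ` topspace (fst (add_basepoint P))"
        proof (cases "y = sphere_point")
          case True
          then show ?thesis
            by (auto simp: g'_def topspace_add_basepoint image_iff)
        next
          case False
          then have "y \<in> \<sigma> ` V"
            using y \<sigma>_bij by (auto simp: bij_betw_def)
          then obtain v where v: "v \<in> V" "y = \<sigma> v"
            by (rule imageE)
          have "1 \<in> \<phi> ` L"
            using \<phi>_bij by (auto simp: bij_betw_def)
          then obtain q where q: "q \<in> L" "\<phi> q = 1"
            by (metis imageE)
          then have "q \<noteq> 0"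
            using \<phi>_eq_0_iff [of q] by simp
          then have p: "(v, q) \<in> T"
            using v q by (simp add: zero_prod_def)
          have "y = g' (Inl (orbit (v, q)))"
            using g'_orbit [OF p] v q by (simp add: sphere_map_def affine_def M.scale_one)
          moreover have "Inl (orbit (v, q)) \<in> topspace (fst (add_basepoint P))"
            unfolding topspace_add_basepoint topspace_P using p by blast
          ultimately show ?thesis
            by (rule image_eqI)
        qed
      qed
    qed
    moreover have "Hausdorff_space ?S"
      unfolding nsphere_def by (intro Hausdorff_space_subtopology Hausdorff_Euclidean_space)
    ultimately show "quotient_map (fst (add_basepoint P)) (fst (pointed_sphere (dim V))) g'"
      unfolding pointed_sphere_def fst_conv
      by (intro continuous_imp_quotient_map g'_cont compact_space_add_basepoint compact_space_P)
    show "g' x = snd (pointed_sphere (dim V))" if "x \<in> topspace (fst (add_basepoint P))" "u x = 0" for x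
      using cases [OF that(1)]
    proof
      assume "\<exists>p. p \<in> T \<and> x = Inl (orbit p)"
      then obtain p where p: "p \<in> T" "x = Inl (orbit p)"
        by blast
      then have "snd p = 0"
        using that(2) u_orbit height_eq_0_iff by simp
      then show ?thesis
        using p g'_orbit sphere_map_eq_sphere_point_iff by (simp add: pointed_sphere_def)
    next
      assume "x = Inr ()"
      then show ?thesis
        by (simp add: g'_def pointed_sphere_def)
    qed
    show "x = y \<or> u x = 0 \<and> u y = 0"
      if x: "x \<in> topspace (fst (add_basepoint P))" and y: "y \<in> topspace (fst (add_basepoint P))"
        and eq: "g' x = g' y" for x y
    proof (cases "u x = 0")
      case True
      then show ?thesis
        using eq by (simp add: u_def)
    next
      case False
      then have "u y \<noteq> 0"
        using eq by (simp add: u_def)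
      obtain p where p: "p \<in> T" "x = Inl (orbit p)"
        using cases [OF x] False u_base by blast
      obtain p' where p': "p' \<in> T" "y = Inl (orbit p')"
        using cases [OF y] \<open>u y \<noteq> 0\<close> u_base by blast
      have nz: "snd p \<noteq> 0" "snd p' \<noteq> 0"
        using False \<open>u y \<noteq> 0\<close> p p' u_orbit height_eq_0_iff by simp_all
      then have "\<phi> (snd p) \<noteq> 0" "\<phi> (snd p') \<noteq> 0"
        using p p' \<phi>_eq_0_iff by auto
      then have "\<sigma> (affine p) = \<sigma> (affine p')"
        using eq p p' g'_orbit by (simp add: sphere_map_def)
      then have "affine p = affine p'"
        using \<sigma>_bij affine_in [OF p(1)] affine_in [OF p'(1)] by (auto simp: bij_betw_def inj_on_def)
      then have "orbit p = orbit p'"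
        using orbit_eq_if_affine_eq p p' nz by blast
      then show ?thesis
        using p p' by simp
    qed
  qed
  then show ?thesis
    by blast
qed

end

lemma cofiber_sequence_line_extension:
  "\<exists>g. cofiber_sequence (add_basepoint M.P) projective_inclusion (add_basepoint P) g
    (pointed_sphere (dim V))"
  by (rule stereographic_projection [OF M.subspace], rule cofiber_sequence_sphere)

end

section \<open>Isotypic parts as eigenspaces\<close>

lemma zeta_powi_eq_iff:
  assumes "n \<ge> 1"
  shows "zeta n powi a = zeta n powi b \<longleftrightarrow> [a = b] (mod int n)"
proof -
  let ?\<theta> = "2 * of_real pi * \<i> / of_nat n :: complex"
  have "zeta n powi c = exp (of_int c * ?\<theta>)" for c
    by (simp add: zeta_def exp_power_int)
  then have "zeta n powi a = zeta n powi b \<longleftrightarrow>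
      (\<exists>m::int. of_int a * ?\<theta> = of_int b * ?\<theta> + (of_int (2 * m) * pi) * \<i>)"
    by (simp add: exp_eq)
  also have "\<dots> \<longleftrightarrow> (\<exists>m::int. a = b + m * int n)"
  proof (rule ex_cong1)
    fix m :: int
    have "of_int a * ?\<theta> = of_int b * ?\<theta> + (of_int (2 * m) * pi) * \<i> \<longleftrightarrow>
        (of_int a :: complex) = of_int b + of_int m * of_nat n"
    proof -
      have "of_int b * ?\<theta> + (of_int (2 * m) * pi) * \<i> = (of_int b + of_int m * of_nat n) * ?\<theta>"
        using assms by (simp add: field_simps)
      moreover have "?\<theta> \<noteq> 0"
        using assms by simp
      ultimately show ?thesis
        by (metis mult_cancel_right)
    qed
    also have "\<dots> \<longleftrightarrow> (of_int a :: complex) = of_int (b + m * int n)"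
      by simp
    also have "\<dots> \<longleftrightarrow> a = b + m * int n"
      by (rule of_int_eq_iff)
    finally show "of_int a * ?\<theta> = of_int b * ?\<theta> + (of_int (2 * m) * pi) * \<i> \<longleftrightarrow> a = b + m * int n" .
  qed
  also have "\<dots> \<longleftrightarrow> [b = a] (mod int n)"
    by (simp add: cong_iff_lin mult.commute)
  also have "\<dots> \<longleftrightarrow> [a = b] (mod int n)"
    by (rule cong_sym_eq)
  finally show ?thesis .
qed

lemma cnj_zeta_powi: "cnj (zeta n powi a) = zeta n powi (- a)"
proof -
  have "cnj (zeta n) = inverse (zeta n)"
    by (simp add: zeta_def exp_cnj exp_minus [symmetric])
  then show ?thesis
    by (simp add: power_int_def power_inverse)
qed

lemma quat_of_complex_hom:
  "quat_of_complex (z + w) = quat_of_complex z + quat_of_complex w"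
  "quat_of_complex (z * w) = quat_of_complex z * quat_of_complex w"
  "quat_of_complex (of_real x) = of_real x"
  "quat_of_complex 1 = 1"
  by (simp_all add: quat_of_complex_def quat_eq_iff of_real_def)

text \<open>
  The linear part of the axioms, which direct sums and restriction of scalars inherit directly.
\<close>

definition linear_action :: "nat \<Rightarrow> ('k::real_algebra_1, 'a::real_vector) rep \<Rightarrow> bool" where
  "linear_action n V \<longleftrightarrow>
     is_left_module (rep_scale V) (rep_space V) \<and>
     (\<forall>j\<in>carrier (integer_mod_group n).
        (\<forall>v\<in>rep_space V. \<forall>w\<in>rep_space V.
           rep_act V j (v + w) = rep_act V j v + rep_act V j w) \<and>
        (\<forall>c. \<forall>v\<in>rep_space V. rep_act V j (rep_scale V c v) = rep_scale V c (rep_act V j v)))"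

text \<open>
  The weights \<open>\<omega> j\<close> act through the left scalar multiplication, whereas \<open>\<Phi>\<^sub>r\<close> and \<open>\<Psi>\<^sub>r\<close> multiply on the
  right; the two agree for central weights.
\<close>

definition eigenspace :: "nat \<Rightarrow> (int \<Rightarrow> 'k) \<Rightarrow> ('k, 'a) rep \<Rightarrow> 'a set" where
  "eigenspace n \<omega> V = {v \<in> rep_space V. \<forall>j\<in>carrier (integer_mod_group n). rep_act V j v = rep_scale V (\<omega> j) v}"

lemma is_left_module_eigenspace:
  fixes V :: "('k::real_algebra_1, 'a::real_vector) rep"
  assumes V: "linear_action n V" 
    and comm: "\<And>c j. j \<in> carrier (integer_mod_group n) \<Longrightarrow> c * \<omega> j = \<omega> j * c"
  shows "is_left_module (rep_scale V) (eigenspace n \<omega> V)"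
proof -
  let ?s = "rep_scale V" and ?V = "rep_space V"
  have m: "subspace ?V" "\<And>c v. v \<in> ?V \<Longrightarrow> ?s c v \<in> ?V"
    "\<And>c v w. \<lbrakk>v \<in> ?V; w \<in> ?V\<rbrakk> \<Longrightarrow> ?s c (v + w) = ?s c v + ?s c w"
    "\<And>c d v. v \<in> ?V \<Longrightarrow> ?s (c + d) v = ?s c v + ?s d v"
    "\<And>c d v. v \<in> ?V \<Longrightarrow> ?s (c * d) v = ?s c (?s d v)"
    "\<And>t v. v \<in> ?V \<Longrightarrow> ?s (of_real t) v = t *\<^sub>R v"
    using V unfolding linear_action_def is_left_module_def by blast+
  have act: "\<And>j v w. \<lbrakk>j \<in> carrier (integer_mod_group n); v \<in> ?V; w \<in> ?V\<rbrakk> \<Longrightarrow>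
        rep_act V j (v + w) = rep_act V j v + rep_act V j w"
    "\<And>j c v. \<lbrakk>j \<in> carrier (integer_mod_group n); v \<in> ?V\<rbrakk> \<Longrightarrow> rep_act V j (?s c v) = ?s c (rep_act V j v)"
    using V unfolding linear_action_def by blast+
  have z: "0 \<in> ?V"
    using m(1) by (rule subspace_0)
  have scale: "?s c v \<in> eigenspace n \<omega> V" if "v \<in> eigenspace n \<omega> V" for c v
    using that by (auto simp: eigenspace_def act m(2) comm simp flip: m(5))
  have "subspace (eigenspace n \<omega> V)"
  proof (rule subspaceI)
    have "rep_act V j 0 = 0" if "j \<in> carrier (integer_mod_group n)" for j
      using act(1) [OF that z z] by simp
    moreover have "?s c 0 = 0" for c
      using m(3) [OF z z, of c] by simp
    ultimately show "0 \<in> eigenspace n \<omega> V"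
      using z by (simp add: eigenspace_def)
    show "v + w \<in> eigenspace n \<omega> V" if "v \<in> eigenspace n \<omega> V" "w \<in> eigenspace n \<omega> V" for v w
      using that subspace_add [OF m(1)] by (simp add: eigenspace_def act m(3))
    show "t *\<^sub>R v \<in> eigenspace n \<omega> V" if "v \<in> eigenspace n \<omega> V" for t v
    proof -
      have "v \<in> ?V"
        using that by (simp add: eigenspace_def)
      then show ?thesis
        using scale [OF that, of "of_real t"] m(6) by simp
    qed
  qed
  then show ?thesis
    using scale m unfolding is_left_module_def by (simp add: eigenspace_def)
qed

text \<open>
  Let \<open>S\<close> be the one-dimensional representation with central weights \<open>\<omega>\<close>.  An isomorphism to \<open>S\<close> shows that each \<open>j\<close> acts
  on a subrepresentation as the scalar \<open>\<omega> j\<close>.  Conversely, each nonzero eigenvector \<open>v\<close> spans a copy of \<open>S\<close>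
  by \<open>c \<mapsto> c v\<close>, which is injective over a division ring.
\<close>

lemma isotypic_eq_eigenspace:
  fixes V :: "('k::real_normed_div_algebra, 'a::real_vector) rep"
  assumes V: "linear_action n V"
    and S: "rep_space S = UNIV" "rep_scale S = (*)"
      "\<And>j q. j \<in> carrier (integer_mod_group n) \<Longrightarrow> rep_act S j q = q * \<omega> j"
    and comm: "\<And>c j. j \<in> carrier (integer_mod_group n) \<Longrightarrow> c * \<omega> j = \<omega> j * c"
  shows "isotypic n V S = eigenspace n \<omega> V"
proof -
  let ?s = "rep_scale V" and ?V = "rep_space V"
  let ?E = "eigenspace n \<omega> V"
  let ?F = "{U. is_subrep n V U \<and> isomorphic_reps n (subrep V U) S}"
  have E: "is_left_module ?s ?E"
    using V comm by (rule is_left_module_eigenspace)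
  then have m: "subspace ?E" "\<And>c v. v \<in> ?E \<Longrightarrow> ?s c v \<in> ?E"
    "\<And>c v w. \<lbrakk>v \<in> ?E; w \<in> ?E\<rbrakk> \<Longrightarrow> ?s c (v + w) = ?s c v + ?s c w"
    "\<And>c d v. v \<in> ?E \<Longrightarrow> ?s (c + d) v = ?s c v + ?s d v"
    "\<And>c d v. v \<in> ?E \<Longrightarrow> ?s (c * d) v = ?s c (?s d v)"
    "\<And>t v. v \<in> ?E \<Longrightarrow> ?s (of_real t) v = t *\<^sub>R v"
    unfolding is_left_module_def by blast+
  have "U \<subseteq> ?E" if U: "is_subrep n V U" "isomorphic_reps n (subrep V U) S" for U
  proof
    fix u assume u: "u \<in> U"
    have sub: "U \<subseteq> ?V" "\<And>c. ?s c u \<in> U"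
      "\<And>j. j \<in> carrier (integer_mod_group n) \<Longrightarrow> rep_act V j u \<in> U"
      using U(1) u unfolding is_subrep_def by blast+
    obtain f where f: "bij_betw f U UNIV" "\<And>c. f (?s c u) = c * f u"
      "\<And>j. j \<in> carrier (integer_mod_group n) \<Longrightarrow> f (rep_act V j u) = f u * \<omega> j"
      using U(2) S u unfolding isomorphic_reps_def subrep_def by auto
    have "rep_act V j u = ?s (\<omega> j) u" if j: "j \<in> carrier (integer_mod_group n)" for j
    proof -
      have "f (rep_act V j u) = f (?s (\<omega> j) u)"
        using f(2) f(3) [OF j] comm [OF j] by simp
      then show ?thesis
        using bij_betw_imp_inj_on [OF f(1)] sub(2) sub(3) [OF j] by (auto dest: inj_onD)
    qed
    then show "u \<in> ?E"
      using sub(1) u by (auto simp: eigenspace_def)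
  qed
  then have "span (\<Union>?F) \<subseteq> ?E"
    using m(1) by (intro span_minimal) auto
  moreover have "v \<in> span (\<Union>?F)" if v: "v \<in> ?E" for v
  proof (cases "v = 0")
    case True
    then show ?thesis
      by (simp add: span_zero)
  next
    case False
    let ?U = "range (\<lambda>c. ?s c v)"
    have one: "?s 1 v = v"
      using m(6) [OF v, of 1] by simp
    have add: "?s c v + ?s d v = ?s (c + d) v" for c d
      using m(4) [OF v] by simp
    have mult: "?s c (?s d v) = ?s (c * d) v" for c d
      using m(5) [OF v] by simp
    have scaleR: "t *\<^sub>R ?s c v = ?s (of_real t * c) v" for t c
      using m(5) [OF v] m(6) [OF m(2) [OF v]] by simp
    have act: "rep_act V j (?s c v) = ?s (c * \<omega> j) v" if j: "j \<in> carrier (integer_mod_group n)" for j c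
      using m(2) [OF v, of c] j mult comm [OF j] by (simp add: eigenspace_def)
    have zero: "?s 0 v = 0"
      using m(6) [OF v, of 0] by simp
    have "?U \<subseteq> ?V"
      using m(2) [OF v] by (auto simp: eigenspace_def)
    moreover have "subspace ?U"
    proof (rule subspaceI)
      show "0 \<in> ?U"
        using zero by (rule range_eqI [OF sym])
    qed (auto simp: add scaleR)
    ultimately have sub: "is_subrep n V ?U"
      unfolding is_subrep_def by (auto simp: mult act)
    have inj: "c = d" if "?s c v = ?s d v" for c d
    proof (rule ccontr)
      assume "c \<noteq> d"
      have "?s (c - d) v + ?s d v = ?s d v"
        using that by (simp add: add)
      then have "?s (c - d) v = 0"
        by simp
      have "v = ?s (inverse (c - d) * (c - d)) v"
        using \<open>c \<noteq> d\<close> by (simp add: one)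
      also have "\<dots> = ?s (inverse (c - d)) (?s (c - d) v)"
        by (simp only: mult)
      also have "\<dots> = ?s (inverse (c - d)) (?s 0 v)"
        by (simp only: \<open>?s (c - d) v = 0\<close> zero)
      also have "\<dots> = ?s (inverse (c - d) * 0) v"
        by (simp only: mult)
      also have "\<dots> = 0"
        by (simp only: mult_zero_right zero)
      finally show False
        using False by simp
    qed
    have "bij_betw (\<lambda>c. ?s c v) UNIV ?U"
      by (auto simp: bij_betw_def inj_on_def intro: inj)
    then have bij: "bij_betw (inv_into UNIV (\<lambda>c. ?s c v)) ?U UNIV"
      by (rule bij_betw_inv_into)
    have inv: "inv_into UNIV (\<lambda>c. ?s c v) (?s c v) = c" for c
      by (rule inv_f_f) (auto simp: inj_on_def intro: inj)
    have "isomorphic_reps n (subrep V ?U) S"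
      unfolding isomorphic_reps_def
      by (rule exI [of _ "inv_into UNIV (\<lambda>c. ?s c v)"])
        (use bij in \<open>auto simp: subrep_def S add mult act inv\<close>)
    moreover have "v \<in> ?U"
      using one by (rule range_eqI [OF sym])
    ultimately show ?thesis
      using sub by (intro span_base) blast
  qed
  ultimately show ?thesis
    unfolding isotypic_def by blast
qed

lemma linear_action_if_is_rep: "is_rep n W \<Longrightarrow> linear_action n W"
  by (simp add: is_rep_def linear_action_def)

lemma linear_action_restrict_scalars:
  "linear_action n W \<Longrightarrow> linear_action n (restrict_scalars W)"
  by (simp add: linear_action_def restrict_scalars_def is_left_module_def quat_of_complex_hom)

lemma linear_action_Psi: "linear_action n (Psi n k)"
  by (auto simp: linear_action_def Psi_def is_left_module_def algebra_simps scaleR_conv_of_real)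

lemma linear_action_direct_sum:
  assumes V: "linear_action n V" and V': "linear_action n V'"
  shows "linear_action n (direct_sum V V')"
proof -
  have "is_left_module (rep_scale V) (rep_space V)" "is_left_module (rep_scale V') (rep_space V')"
    using assms by (simp_all add: linear_action_def)
  then have "is_left_module (rep_scale (direct_sum V V')) (rep_space (direct_sum V V'))"
    by (simp add: direct_sum_def is_left_module_prod)
  moreover from this have "\<And>x y. \<lbrakk>x \<in> rep_space (direct_sum V V'); y \<in> rep_space (direct_sum V V')\<rbrakk>
        \<Longrightarrow> x + y \<in> rep_space (direct_sum V V')"
    "\<And>c x. x \<in> rep_space (direct_sum V V') \<Longrightarrow> rep_scale (direct_sum V V') c x \<in> rep_space (direct_sum V V')"
    unfolding is_left_module_def by (blast intro: subspace_add)+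
  ultimately show ?thesis
    using assms by (auto simp: linear_action_def direct_sum_def)
qed

lemma eigenspace_direct_sum:
  "eigenspace n \<omega> (direct_sum V V') = eigenspace n \<omega> V \<times> eigenspace n \<omega> V'"
  by (auto simp: eigenspace_def direct_sum_def)

definition zeta_character :: "nat \<Rightarrow> int \<Rightarrow> int \<Rightarrow> quat" where
  "zeta_character n r j = quat_of_complex ((zeta n powi r) powi j)"

lemma eigenspace_restrict_scalars:
  "eigenspace n \<omega> (restrict_scalars W) = eigenspace n (\<lambda>j. quat_of_complex (\<omega> j)) W"
  by (simp add: eigenspace_def restrict_scalars_def)

lemma isotypic_C_eq_eigenspace:
  fixes W :: "(quat, 'a::real_vector) rep"
  assumes "linear_action n W"
  shows "isotypic_C n r W = eigenspace n (zeta_character n r) W"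
proof -
  have "isotypic_C n r W = eigenspace n (\<lambda>j. (zeta n powi r) powi j) (restrict_scalars W)"
    unfolding isotypic_C_def using linear_action_restrict_scalars [OF assms]
    by (rule isotypic_eq_eigenspace) (simp_all add: Phi_def)
  then show ?thesis
    by (simp add: eigenspace_restrict_scalars zeta_character_def [abs_def])
qed

text \<open>
  If \<open>2r \<equiv> 0\<close> then \<open>\<zeta>\<^sup>r\<close> equals its conjugate \<open>\<zeta>\<^sup>-\<^sup>r\<close>, so its powers are real.
\<close>

lemma zeta_character_central:
  assumes "n \<ge> 1" "[2 * r = 0] (mod int n)"
  shows "c * zeta_character n r j = zeta_character n r j * c"
proof -
  have "[r + r - r = 0 - r] (mod int n)"
    using assms(2) by (intro cong_diff) simp_all
  then have "[- r = r] (mod int n)"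
    by (simp add: cong_sym_eq)
  then have "cnj (zeta n powi r) = zeta n powi r"
    using assms(1) zeta_powi_eq_iff cnj_zeta_powi by metis
  then have "cnj ((zeta n powi r) powi j) = (zeta n powi r) powi j"
    by (simp only: complex_cnj_power_int)
  moreover have "Im w = 0" if "cnj w = w" for w
    using arg_cong [OF that, of Im] by simp
  ultimately have "Im ((zeta n powi r) powi j) = 0"
    by blast
  then show ?thesis
    by (simp add: zeta_character_def quat_of_complex_def quat_eq_iff)
qed

lemma isotypic_H_eq_eigenspace:
  fixes W :: "(quat, 'a::real_vector) rep"
  assumes "linear_action n W" "n \<ge> 1" "[2 * r = 0] (mod int n)"
  shows "isotypic_H n r W = eigenspace n (zeta_character n r) W"
  unfolding isotypic_H_def using assms(1)
  by (rule isotypic_eq_eigenspace)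
    (simp_all add: Psi_def zeta_character_central [OF assms(2,3)] flip: zeta_character_def)

text \<open>
  With \<open>q = a + b j\<close> one has \<open>q w = a w + b cnj w j\<close> for complex \<open>w\<close>, because \<open>j w = cnj w j\<close>.
\<close>

lemma quat_intertwine_iff:
  "q * quat_of_complex w = quat_of_complex w' * q \<longleftrightarrow>
     Complex (qRe q) (qI q) * w = Complex (qRe q) (qI q) * w' \<and>
     Complex (qJ q) (qK q) * cnj w = Complex (qJ q) (qK q) * w'"
  by (auto simp: quat_eq_iff quat_of_complex_def complex_eq_iff algebra_simps)

text \<open>
  The component \<open>a\<close> survives if \<open>\<zeta>\<^sup>k = \<zeta>\<^sup>r\<close>, the component \<open>b\<close> if \<open>\<zeta>\<^sup>-\<^sup>k = \<zeta>\<^sup>r\<close>.  The condition at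
  the generator 1 decides; for \<open>n = 1\<close>, where 1 does not lie in the carrier, all congruences hold.
\<close>

lemma eigenspace_Psi:
  assumes n: "n \<ge> 1"
  shows "eigenspace n (zeta_character n r) (Psi n k) =
    {q. (\<not> [k = r] (mod int n) \<longrightarrow> qRe q = 0 \<and> qI q = 0) \<and>
        (\<not> [k = - r] (mod int n) \<longrightarrow> qJ q = 0 \<and> qK q = 0)}"
proof -
  have kr: "zeta n powi k = zeta n powi r \<longleftrightarrow> [k = r] (mod int n)"
    using n by (rule zeta_powi_eq_iff)
  have "cnj (zeta n powi k) = zeta n powi r \<longleftrightarrow> [- k = r] (mod int n)"
    using zeta_powi_eq_iff [OF n] by (simp only: cnj_zeta_powi)
  also have "\<dots> \<longleftrightarrow> [k = - r] (mod int n)"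
    using cong_minus_minus_iff [of k "- r" "int n"] by simp
  finally have kr': "cnj (zeta n powi k) = zeta n powi r \<longleftrightarrow> [k = - r] (mod int n)" .
  have "q \<in> eigenspace n (zeta_character n r) (Psi n k) \<longleftrightarrow>
      (\<not> [k = r] (mod int n) \<longrightarrow> Complex (qRe q) (qI q) = 0) \<and>
      (\<not> [k = - r] (mod int n) \<longrightarrow> Complex (qJ q) (qK q) = 0)" for q
  proof
    assume "q \<in> eigenspace n (zeta_character n r) (Psi n k)"
    then have *: "Complex (qRe q) (qI q) * (zeta n powi k) powi j = Complex (qRe q) (qI q) * (zeta n powi r) powi j"
      "Complex (qJ q) (qK q) * cnj ((zeta n powi k) powi j) = Complex (qJ q) (qK q) * (zeta n powi r) powi j"
      if "j \<in> carrier (integer_mod_group n)" for j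
      using that by (simp_all add: eigenspace_def Psi_def zeta_character_def quat_intertwine_iff)
    show "(\<not> [k = r] (mod int n) \<longrightarrow> Complex (qRe q) (qI q) = 0) \<and>
      (\<not> [k = - r] (mod int n) \<longrightarrow> Complex (qJ q) (qK q) = 0)"
    proof (cases "n = 1")
      case False
      then have "1 \<in> carrier (integer_mod_group n)"
        using n by (simp add: carrier_integer_mod_group)
      from *[OF this] show ?thesis
        unfolding kr [symmetric] kr' [symmetric] by auto
    qed simp
  next
    assume *: "(\<not> [k = r] (mod int n) \<longrightarrow> Complex (qRe q) (qI q) = 0) \<and>
      (\<not> [k = - r] (mod int n) \<longrightarrow> Complex (qJ q) (qK q) = 0)"
    then have "Complex (qRe q) (qI q) * (zeta n powi k) powi j = Complex (qRe q) (qI q) * (zeta n powi r) powi j"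
      "Complex (qJ q) (qK q) * cnj ((zeta n powi k) powi j) = Complex (qJ q) (qK q) * (zeta n powi r) powi j" for j
      unfolding kr [symmetric] kr' [symmetric] complex_cnj_power_int by auto
    then show "q \<in> eigenspace n (zeta_character n r) (Psi n k)"
      by (simp add: eigenspace_def Psi_def zeta_character_def quat_intertwine_iff)
  qed
  then show ?thesis
    by (auto simp: complex_eq_iff)
qed

section \<open>The cofiber sequence\<close>

lemma rep_scale_direct_sum:
  "rep_scale (direct_sum W (Psi n k)) = (\<lambda>c (v, q). (rep_scale W c v, c * q))"
  "rep_scale (restrict_scalars (direct_sum W (Psi n k))) =
     (\<lambda>z (v, q). (rep_scale (restrict_scalars W) z v, quat_of_complex z * q))"
  by (simp_all add: direct_sum_def restrict_scalars_def Psi_def)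

lemma is_left_module_eigenspace_complex:
  fixes W :: "(quat, 'a::real_vector) rep"
  assumes "linear_action n W"
  shows "is_left_module (rep_scale (restrict_scalars W)) (eigenspace n (zeta_character n r) W)"
  using is_left_module_eigenspace [OF linear_action_restrict_scalars [OF assms],
      of "\<lambda>j. (zeta n powi r) powi j"]
  by (simp add: eigenspace_restrict_scalars zeta_character_def [abs_def] mult.commute)

lemma P_H_eq_projective_space:
  fixes W :: "(quat, 'a::{real_vector, topological_space}) rep"
  assumes "linear_action n W" "n \<ge> 1"
  shows "P_H n r W =
    (if [2 * r = 0] (mod int n)
     then projective_space (rep_scale W) (eigenspace n (zeta_character n r) W)
     else projective_space (rep_scale (restrict_scalars W)) (eigenspace n (zeta_character n r) W))"
  using assms by (simp add: P_H_def isotypic_C_eq_eigenspace isotypic_H_eq_eigenspace)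

theorem theorem3p33:
  fixes n :: nat and k r :: int and W :: "(quat, 'a::euclidean_space) rep"
  assumes "n \<ge> 1" and "is_rep n W"
  shows "embedding_map (fst (add_basepoint (P_H n r W)))
           (fst (add_basepoint (P_H n r (direct_sum W (Psi n k))))) projective_inclusion \<and>
         (\<exists>g. cofiber_sequence
           (add_basepoint (P_H n r W))
           projective_inclusion
           (add_basepoint (P_H n r (direct_sum W (Psi n k))))
           g
           (if [k = r] (mod int n) \<or> [k = - r] (mod int n)
            then pointed_sphere (dim (isotypic_C n r W))
            else pointed_pt))"
proof -
  let ?V = "eigenspace n (zeta_character n r) W"
  let ?L = "eigenspace n (zeta_character n r) (Psi n k)"
  have W: "linear_action n W"
    using assms(2) by (rule linear_action_if_is_rep)
  then have sum: "linear_action n (direct_sum W (Psi n k))"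
    using linear_action_Psi by (rule linear_action_direct_sum)
  note L = eigenspace_Psi [OF assms(1), of r k]
  note PW = P_H_eq_projective_space [OF W assms(1), of r]
  note PS = P_H_eq_projective_space [OF sum assms(1), of r, unfolded eigenspace_direct_sum rep_scale_direct_sum]
  note C = isotypic_C_eq_eigenspace [OF W, of r]
  show ?thesis
  proof (cases "[2 * r = 0] (mod int n)")
    case True
    then have "[r - (2 * r) = r - 0] (mod int n)"
      by (intro cong_diff cong_refl)
    \<comment> \<open>The quaternionic case, where \<open>k \<equiv> r\<close> and \<open>k \<equiv> - r\<close> are the same condition.\<close>
    then have "[- r = r] (mod int n)"
      by simp
    then have same: "[k = - r] (mod int n) \<longleftrightarrow> [k = r] (mod int n)"
      by (meson cong_sym cong_trans)
    interpret two_modules "rep_scale W" ?V "(*)" ?L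
    proof unfold_locales
      show "is_left_module (rep_scale W) ?V"
        by (rule is_left_module_eigenspace [OF W zeta_character_central [OF assms(1) True]])
      show "is_left_module (*) ?L"
        using is_left_module_eigenspace [OF linear_action_Psi [of n k] zeta_character_central [OF assms(1) True]]
        by (simp add: Psi_def)
    qed
    note P = PW PS if_P [OF True]
    have "\<exists>g. cofiber_sequence (add_basepoint M.P) projective_inclusion (add_basepoint P) g
        (if [k = r] (mod int n) \<or> [k = - r] (mod int n) then pointed_sphere (dim ?V) else pointed_pt)"
    proof (cases "[k = r] (mod int n)")
      case kr: True
      then have "?L = UNIV"
        unfolding L same by simp
      then interpret line_extension "rep_scale W" ?V "(*)" ?L id
        by (intro line_extension.intro two_modules_axioms line_extension_axioms.intro)
          (simp_all add: bounded_linear_ident [folded id_def])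
      show ?thesis
        using kr cofiber_sequence_line_extension by simp
    next
      case False
      then have "?L = {0}"
        unfolding L same by (auto simp: quat_eq_iff)
      then show ?thesis
        using False same cofiber_sequence_trivial_extension by auto
    qed
    then show ?thesis
      unfolding C P using embedding_map_projective_inclusion by blast
  next
    case False
    \<comment> \<open>The complex case, where at most one of the two congruences holds.\<close>
    interpret two_modules "rep_scale (restrict_scalars W)" ?V "\<lambda>z. (*) (quat_of_complex z)" ?L
    proof unfold_locales
      show "is_left_module (rep_scale (restrict_scalars W)) ?V"
        by (rule is_left_module_eigenspace_complex [OF W])
      show "is_left_module (\<lambda>z. (*) (quat_of_complex z)) ?L"
        using is_left_module_eigenspace_complex [OF linear_action_Psi [of n k], of r]
        by (simp add: Psi_def restrict_scalars_def)
    qed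
    have not_both: "\<not> ([k = r] (mod int n) \<and> [k = - r] (mod int n))"
    proof
      assume "[k = r] (mod int n) \<and> [k = - r] (mod int n)"
      then have "[k - k = r - - r] (mod int n)"
        by (intro cong_diff) simp_all
      then show False
        using False by (simp add: cong_sym_eq)
    qed
    note P = PW PS if_not_P [OF False]
    have "\<exists>g. cofiber_sequence (add_basepoint M.P) projective_inclusion (add_basepoint P) g
        (if [k = r] (mod int n) \<or> [k = - r] (mod int n) then pointed_sphere (dim ?V) else pointed_pt)"
    proof -
      consider "[k = r] (mod int n)" "\<not> [k = - r] (mod int n)"
        | "\<not> [k = r] (mod int n)" "[k = - r] (mod int n)"
        | "\<not> [k = r] (mod int n)" "\<not> [k = - r] (mod int n)"
        using not_both by blast
      then show ?thesis
      proof cases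
        case 1
        then have L1: "?L = {q. qJ q = 0 \<and> qK q = 0}"
          unfolding L by simp
        \<comment> \<open>\<open>L\<close> consists of the quaternions \<open>a\<close> with \<open>a\<close> complex.\<close>
        let ?\<phi> = "\<lambda>q. Complex (qRe q) (qI q)"
        interpret line_extension "rep_scale (restrict_scalars W)" ?V "\<lambda>z. (*) (quat_of_complex z)" ?L ?\<phi>
        proof (intro line_extension.intro two_modules_axioms line_extension_axioms.intro)
          show "bounded_linear ?\<phi>"
            unfolding linear_conv_bounded_linear [symmetric]
            by (rule linearI) (simp_all add: complex_eq_iff)
          show "bij_betw ?\<phi> ?L UNIV"
            unfolding L1 by (rule bij_betw_byWitness [where f' = quat_of_complex])
              (auto simp: quat_of_complex_def quat_eq_iff complex_eq_iff)
          show "?\<phi> (quat_of_complex z * q) = z * ?\<phi> q" for z q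
            by (simp add: quat_of_complex_def complex_eq_iff)
        qed
        show ?thesis
          using 1 cofiber_sequence_line_extension by simp
      next
        case 2
        then have L2: "?L = {q. qRe q = 0 \<and> qI q = 0}"
          unfolding L by simp
        \<comment> \<open>\<open>L\<close> consists of the quaternions \<open>b j\<close> with \<open>b\<close> complex.\<close>
        let ?\<phi> = "\<lambda>q. Complex (qJ q) (qK q)"
        interpret line_extension "rep_scale (restrict_scalars W)" ?V "\<lambda>z. (*) (quat_of_complex z)" ?L ?\<phi>
        proof (intro line_extension.intro two_modules_axioms line_extension_axioms.intro)
          show "bounded_linear ?\<phi>"
            unfolding linear_conv_bounded_linear [symmetric]
            by (rule linearI) (simp_all add: complex_eq_iff)
          show "bij_betw ?\<phi> ?L UNIV"
            unfolding L2 by (rule bij_betw_byWitness [where f' = "\<lambda>z. Quat 0 0 (Re z) (Im z)"])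
              (auto simp: quat_eq_iff complex_eq_iff)
          show "?\<phi> (quat_of_complex z * q) = z * ?\<phi> q" for z q
            by (simp add: quat_of_complex_def complex_eq_iff)
        qed
        show ?thesis
          using 2 cofiber_sequence_line_extension by simp
      next
        case 3
        then have "?L = {0}"
          unfolding L by (auto simp: quat_eq_iff)
        then show ?thesis
          using 3 cofiber_sequence_trivial_extension by auto
      qed
    qed
    then show ?thesis
      unfolding C P using embedding_map_projective_inclusion by blast
  qed
qed

end
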